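(* Let $(S,s_0,\varepsilon_S,\delta_S)$ and $(U,u_0,\varepsilon_U,\delta_U)$ be finite symbolic GKAT automata, let $s\in S$, $u\in U$, and consider the symbolic function EQUIV given in the context, started with a fresh union-find object. Then EQUIV$(s,u)$ always terminates, and it is sound and complete: (1) EQUIV$(s,u)$ returns true if and only if $s$ and $u$ are trace-equivalent in the concretizations of the two automata; (2) if ISDEAD and KNOWNDEAD are both replaced by the constant false function, then EQUIV$(s,u)$ returns true if and only if $s$ and $u$ are bisimilar in the concretizations.
   Context: Fix a finite set $T$ of primitive tests and a set $\Sigma$ of primitive actions. $\mathsf{BExp}$ is the set of Boolean expressions over $T$ (built from $0,1,t\in T,\wedge,\vee,\overline{\cdot}$); $b\equiv c$ means equivalence in Boolean algebra. An atom is a truth assignment to all of $T$; $\mathbf{At}$ is the set of atoms. A (concrete) GKAT automaton is $(S,s_0,\zeta)$ with a finite set $S$, $s_0\in S$, and $\zeta:S\to\mathbf{At}\to\{\bot,\mathrm{ret}\}+S\times\Sigma$. For an atom $\alpha$: "$s$ accepts $\alpha$" means $\zeta(s)_\alpha=\mathrm{ret}$; "$s$ rejects $\alpha$" means $\zeta(s)_\alpha=\bot$; $s\xrightarrow{\alpha\mid p}s'$ means $\zeta(s)_\alpha=(s',p)$. Trace semantics: $[\![s]\!]$ is the least family of sets of finite words such that: if $s$ accepts $\alpha$ then $\alpha\in[\![s]\!]$; if $s\xrightarrow{\alpha\mid p}s'$ and $w\in[\![s']\!]$ then $\alpha p\cdot w\in[\![s]\!]$. States $s,u$ are trace-equivalent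 if $[\![s]\!]=[\![u]\!]$. They are bisimilar if there is a relation $B\ni(s,u)$ such that for all $(x,y)\in B$ and all $\alpha$: both accept $\alpha$, or both reject $\alpha$, or $x\xrightarrow{\alpha\mid p}x'$ and $y\xrightarrow{\alpha\mid p}y'$ for the same $p$ with $(x',y')\in B$. A symbolic GKAT automaton is $(S,s_0,\varepsilon,\delta)$ with a finite state set $S$, $s_0\in S$, $\varepsilon:S\to\mathcal P(\mathsf{BExp})$, $\delta:S\to\mathcal P(\mathsf{BExp}\times S\times\Sigma)$, satisfying disjointedness: for any state $s$ and any two distinct elements of $\varepsilon(s)\cup\delta(s)$, the conjunction of their Boolean expressions is $\equiv 0$. "Finite" means that $S$ and all sets $\varepsilon(s),\delta(s)$ are finite. Write $s\xrightarrow{b\mid p}s'$ for $(b,s',p)\in\delta(s)$. Put $\rho(s)=\bigwedge(\{\overline b\mid b\in\varepsilon(s)\}\cup\{\overline b\mid(b,s',p)\in\delta(s)\})$. The concretization is the GKAT automaton with the same states and start state and $\zeta(s)_\alpha=\mathrm{ret}$ if $\alpha$ satisfies some $b\in\varepsilon(s)$; $\zeta(s)_\alpha=(s',p)$ if $\alpha$ satisfies $b$ for some $(b,s',p)\in\delta(s)$; $\zeta(s)_\alpha=\bot$ otherwise. ISDEAD$(s)$: if $s$ is in the cache of known dead states, return true; otherwise perform a depth-first search from $s$ along non-blocked transitions ($x\xrightarrow{b\mid p}x'$ with $b\not\equiv0$); if no reachable state $x$ (including $s$) has $\bigvee\varepsilon(x)\not\equiv0$, add all reached states to the cache and return true, else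 return false. KNOWNDEAD$(s)$ returns whether $s$ is in the cache. A union-find object on the disjoint union $S+U$ is maintained: UNION$(s,u)$ merges the classes of $s$ and $u$; REP$(s)$ returns the representative of the class of $s$. In a fresh union-find object all classes are singletons. Function EQUIV$(s,u)$: - if REP$(s)=$ REP$(u)$, return true; - call UNION$(s,u)$; - if KNOWNDEAD$(s)$, return ISDEAD$(u)$; - if KNOWNDEAD$(u)$, return ISDEAD$(s)$; - return the conjunction, evaluated sequentially with short-circuiting, of the following, over all transitions of $s$ and $u$: (i) $\bigvee\varepsilon(s)\equiv\bigvee\varepsilon(u)$; (ii) if $s\xrightarrow{b\mid p}s'$ and $b\wedge\rho(u)\not\equiv0$, then ISDEAD$(s')$; (iii) if $u\xrightarrow{b\mid p}u'$ and $b\wedge\rho(s)\not\equiv0$, then ISDEAD$(u')$; (iv) if $s\xrightarrow{b\mid p}s'$, $u\xrightarrow{a\mid q}u'$, $b\wedge a\not\equiv0$ and $p\ne q$, then ISDEAD$(s')$ and ISDEAD$(u')$; (v) if $s\xrightarrow{b\mid p}s'$, $u\xrightarrow{a\mid p}u'$ and $b\wedge a\not\equiv0$, then EQUIV$(s',u')$ (recursive call, sharing the union-find object and the cache). *)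

theory Defs
  imports Main "HOL-Library.Monad_Syntax"
begin

section \<open>Boolean expressions and atoms\<close>

datatype (tests: 't) bexp =
    BZero
  | BOne
  | BTest 't
  | BAnd "'t bexp" "'t bexp"
  | BOr "'t bexp" "'t bexp"
  | BNot "'t bexp"

definition BExp :: "'t set \<Rightarrow> 't bexp set" where
  "BExp T = {b. tests b \<subseteq> T}"

text \<open>Derivability of an equation from the axioms of Boolean algebra.\<close>

inductive ba_equiv :: "'t bexp \<Rightarrow> 't bexp \<Rightarrow> bool"  (infix "\<equiv>\<^sub>B\<^sub>A" 50) where
  refl: "b \<equiv>\<^sub>B\<^sub>A b"
| sym: "b \<equiv>\<^sub>B\<^sub>A c \<Longrightarrow> c \<equiv>\<^sub>B\<^sub>A b"
| trans: "b \<equiv>\<^sub>B\<^sub>A c \<Longrightarrow> c \<equiv>\<^sub>B\<^sub>A d \<Longrightarrow> b \<equiv>\<^sub>B\<^sub>A d"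
| cong_And: "b \<equiv>\<^sub>B\<^sub>A b' \<Longrightarrow> c \<equiv>\<^sub>B\<^sub>A c' \<Longrightarrow> BAnd b c \<equiv>\<^sub>B\<^sub>A BAnd b' c'"
| cong_Or: "b \<equiv>\<^sub>B\<^sub>A b' \<Longrightarrow> c \<equiv>\<^sub>B\<^sub>A c' \<Longrightarrow> BOr b c \<equiv>\<^sub>B\<^sub>A BOr b' c'"
| cong_Not: "b \<equiv>\<^sub>B\<^sub>A b' \<Longrightarrow> BNot b \<equiv>\<^sub>B\<^sub>A BNot b'"
| assoc_And: "BAnd (BAnd b c) d \<equiv>\<^sub>B\<^sub>A BAnd b (BAnd c d)"
| assoc_Or: "BOr (BOr b c) d \<equiv>\<^sub>B\<^sub>A BOr b (BOr c d)"
| commute_And: "BAnd b c \<equiv>\<^sub>B\<^sub>A BAnd c b"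
| commute_Or: "BOr b c \<equiv>\<^sub>B\<^sub>A BOr c b"
| absorb_And: "BAnd b (BOr b c) \<equiv>\<^sub>B\<^sub>A b"
| absorb_Or: "BOr b (BAnd b c) \<equiv>\<^sub>B\<^sub>A b"
| distrib_And: "BAnd b (BOr c d) \<equiv>\<^sub>B\<^sub>A BOr (BAnd b c) (BAnd b d)"
| distrib_Or: "BOr b (BAnd c d) \<equiv>\<^sub>B\<^sub>A BAnd (BOr b c) (BOr b d)"
| ident_And: "BAnd b BOne \<equiv>\<^sub>B\<^sub>A b"
| ident_Or: "BOr b BZero \<equiv>\<^sub>B\<^sub>A b"
| compl_And: "BAnd b (BNot b) \<equiv>\<^sub>B\<^sub>A BZero"
| compl_Or: "BOr b (BNot b) \<equiv>\<^sub>B\<^sub>A BOne"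

text \<open>The conjunction and the disjunction of a finite set are determined only up to
  \<open>\<equiv>\<^sub>B\<^sub>A\<close>, so the set may be enumerated in any way. Both are meant for finite sets only.\<close>

definition enumeration :: "'x set \<Rightarrow> 'x list" where
  "enumeration X = (SOME xs. distinct xs \<and> set xs = X)"

definition BigAnd :: "'t bexp set \<Rightarrow> 't bexp" where
  "BigAnd X = foldr BAnd (enumeration X) BOne"

definition BigOr :: "'t bexp set \<Rightarrow> 't bexp" where
  "BigOr X = foldr BOr (enumeration X) BZero"

text \<open>A truth assignment to \<open>T\<close> is represented by the set of those tests in \<open>T\<close> that it
  makes true.\<close>

type_synonym 't atom = "'t set"

definition At :: "'t set \<Rightarrow> 't atom set" where
  "At T = Pow T"

primrec satisfies :: "'t atom \<Rightarrow> 't bexp \<Rightarrow> bool" where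
  "satisfies \<alpha> BZero \<longleftrightarrow> False"
| "satisfies \<alpha> BOne \<longleftrightarrow> True"
| "satisfies \<alpha> (BTest t) \<longleftrightarrow> t \<in> \<alpha>"
| "satisfies \<alpha> (BAnd b c) \<longleftrightarrow> satisfies \<alpha> b \<and> satisfies \<alpha> c"
| "satisfies \<alpha> (BOr b c) \<longleftrightarrow> satisfies \<alpha> b \<or> satisfies \<alpha> c"
| "satisfies \<alpha> (BNot b) \<longleftrightarrow> \<not> satisfies \<alpha> b"


section \<open>GKAT automata\<close>

datatype ('s, 'p) outcome = Reject | Accept | Step 's 'p

record ('t, 's, 'p) gkat_automaton =
  gstates :: "'s set"
  gstart :: 's
  zeta :: "'s \<Rightarrow> 't atom \<Rightarrow> ('s, 'p) outcome"

text \<open>Words alternate between atoms and actions: \<open>\<alpha>\<close> is \<open>[Inl \<alpha>]\<close>, and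
  \<open>\<alpha> p \<cdot> w\<close> is \<open>Inl \<alpha> # Inr p # w\<close>.\<close>

inductive is_trace ::
    "'t set \<Rightarrow> ('t, 's, 'p) gkat_automaton \<Rightarrow> 's \<Rightarrow> ('t atom + 'p) list \<Rightarrow> bool"
  for T X where
  accept: "\<alpha> \<in> At T \<Longrightarrow> zeta X s \<alpha> = Accept \<Longrightarrow> is_trace T X s [Inl \<alpha>]"
| step: "\<alpha> \<in> At T \<Longrightarrow> zeta X s \<alpha> = Step s' p \<Longrightarrow> is_trace T X s' w
    \<Longrightarrow> is_trace T X s (Inl \<alpha> # Inr p # w)"

definition traces ::
    "'t set \<Rightarrow> ('t, 's, 'p) gkat_automaton \<Rightarrow> 's \<Rightarrow> ('t atom + 'p) list set" where
  "traces T X s = {w. is_trace T X s w}"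

definition trace_equivalent ::
    "'t set \<Rightarrow> ('t, 's, 'p) gkat_automaton \<Rightarrow> ('t, 'u, 'p) gkat_automaton \<Rightarrow> 's \<Rightarrow> 'u \<Rightarrow> bool" where
  "trace_equivalent T X Y s u \<longleftrightarrow> traces T X s = traces T Y u"

definition bisimulation ::
    "'t set \<Rightarrow> ('t, 's, 'p) gkat_automaton \<Rightarrow> ('t, 'u, 'p) gkat_automaton \<Rightarrow> ('s \<times> 'u) set \<Rightarrow> bool" where
  "bisimulation T X Y R \<longleftrightarrow>
     R \<subseteq> gstates X \<times> gstates Y \<and>
     (\<forall>(x, y) \<in> R. \<forall>\<alpha> \<in> At T.
        (zeta X x \<alpha> = Accept \<and> zeta Y y \<alpha> = Accept) \<or>
        (zeta X x \<alpha> = Reject \<and> zeta Y y \<alpha> = Reject) \<or>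
        (\<exists>p x' y'. zeta X x \<alpha> = Step x' p \<and> zeta Y y \<alpha> = Step y' p \<and> (x', y') \<in> R))"

definition bisimilar ::
    "'t set \<Rightarrow> ('t, 's, 'p) gkat_automaton \<Rightarrow> ('t, 'u, 'p) gkat_automaton \<Rightarrow> 's \<Rightarrow> 'u \<Rightarrow> bool" where
  "bisimilar T X Y s u \<longleftrightarrow> (\<exists>R. bisimulation T X Y R \<and> (s, u) \<in> R)"


section \<open>Symbolic GKAT automata\<close>

record ('t, 's, 'p) symbolic_automaton =
  states :: "'s set"
  start :: 's
  eps :: "'s \<Rightarrow> 't bexp set"
  delta :: "'s \<Rightarrow> ('t bexp \<times> 's \<times> 'p) set"

text \<open>The union of \<open>\<epsilon>(s)\<close> and \<open>\<delta>(s)\<close> is a disjoint one, and \<open>guard\<close> extracts the Boolean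
  expression of an element of it.\<close>

definition guard :: "'t bexp + 't bexp \<times> 's \<times> 'p \<Rightarrow> 't bexp" where
  "guard = case_sum (\<lambda>b. b) fst"

definition symbolic_gkat ::
    "'t set \<Rightarrow> 'p set \<Rightarrow> ('t, 's, 'p) symbolic_automaton \<Rightarrow> bool" where
  "symbolic_gkat T \<Sigma> A \<longleftrightarrow>
     finite (states A) \<and> start A \<in> states A \<and>
     (\<forall>s \<in> states A.
        eps A s \<subseteq> BExp T \<and> delta A s \<subseteq> BExp T \<times> states A \<times> \<Sigma> \<and>
        (\<forall>e \<in> eps A s <+> delta A s. \<forall>f \<in> eps A s <+> delta A s.
           e \<noteq> f \<longrightarrow> BAnd (guard e) (guard f) \<equiv>\<^sub>B\<^sub>A BZero))"

definition finite_symbolic_gkat ::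
    "'t set \<Rightarrow> 'p set \<Rightarrow> ('t, 's, 'p) symbolic_automaton \<Rightarrow> bool" where
  "finite_symbolic_gkat T \<Sigma> A \<longleftrightarrow>
     symbolic_gkat T \<Sigma> A \<and> (\<forall>s \<in> states A. finite (eps A s) \<and> finite (delta A s))"

definition rho :: "('t, 's, 'p) symbolic_automaton \<Rightarrow> 's \<Rightarrow> 't bexp" where
  "rho A s = BigAnd ({BNot b | b. b \<in> eps A s} \<union> {BNot b | b s' p. (b, s', p) \<in> delta A s})"

text \<open>By disjointedness, the pair \<open>(s', p)\<close> below is unique.\<close>

definition concretization ::
    "('t, 's, 'p) symbolic_automaton \<Rightarrow> ('t, 's, 'p) gkat_automaton" where
  "concretization A =
     \<lparr> gstates = states A,
       gstart = start A,
       zeta = (\<lambda>s \<alpha>.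
         if \<exists>b \<in> eps A s. satisfies \<alpha> b then Accept
         else if \<exists>(b, s', p) \<in> delta A s. satisfies \<alpha> b
         then case (THE (s', p). \<exists>b. (b, s', p) \<in> delta A s \<and> satisfies \<alpha> b) of (s', p) \<Rightarrow> Step s' p
         else Reject) \<rparr>"


section \<open>The decision procedure\<close>

text \<open>States of the two automata are handled together as elements of \<open>'s + 'u\<close>.\<close>

definition eps_sum ::
    "('t, 's, 'p) symbolic_automaton \<Rightarrow> ('t, 'u, 'p) symbolic_automaton
      \<Rightarrow> 's + 'u \<Rightarrow> 't bexp set" where
  "eps_sum A B = case_sum (eps A) (eps B)"

definition nonblocked ::
    "('t, 's, 'p) symbolic_automaton \<Rightarrow> ('t, 'u, 'p) symbolic_automaton
      \<Rightarrow> (('s + 'u) \<times> ('s + 'u)) set" where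
  "nonblocked A B =
     {(Inl x, Inl x') | x x' b p. (b, x', p) \<in> delta A x \<and> \<not> b \<equiv>\<^sub>B\<^sub>A BZero} \<union>
     {(Inr y, Inr y') | y y' b p. (b, y', p) \<in> delta B y \<and> \<not> b \<equiv>\<^sub>B\<^sub>A BZero}"

definition dead ::
    "('t, 's, 'p) symbolic_automaton \<Rightarrow> ('t, 'u, 'p) symbolic_automaton \<Rightarrow> 's + 'u \<Rightarrow> bool" where
  "dead A B x \<longleftrightarrow> (\<forall>y. (x, y) \<in> (nonblocked A B)\<^sup>* \<longrightarrow> BigOr (eps_sum A B y) \<equiv>\<^sub>B\<^sub>A BZero)"

text \<open>A union-find object is represented by its \<open>REP\<close> function; two elements are in the
  same class iff they have the same representative. Which representative a merged class
  gets, namely one of its members, is decided by the parameter \<open>pick\<close>.\<close>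

type_synonym 'x union_find = "'x \<Rightarrow> 'x"

definition fresh_union_find :: "'x union_find" where
  "fresh_union_find = (\<lambda>x. x)"

definition uf_union ::
    "('x union_find \<Rightarrow> 'x \<Rightarrow> 'x \<Rightarrow> 'x) \<Rightarrow> 'x \<Rightarrow> 'x \<Rightarrow> 'x union_find \<Rightarrow> 'x union_find" where
  "uf_union pick x y rep =
     (\<lambda>z. if rep z = rep x \<or> rep z = rep y then pick rep x y else rep z)"

text \<open>The memory consists of the union-find object and the cache of known dead states.\<close>

type_synonym 'x memory = "'x union_find \<times> 'x set"

text \<open>The conjuncts evaluated in a call on \<open>(s, u)\<close>; an implication with a false premise
  counts as a conjunct that is true.\<close>

datatype ('t, 's, 'u, 'p) conjunct =
    SameAcceptance
  | LeftRejected "'t bexp \<times> 's \<times> 'p"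
  | RightRejected "'t bexp \<times> 'u \<times> 'p"
  | DifferentActions "'t bexp \<times> 's \<times> 'p" "'t bexp \<times> 'u \<times> 'p"
  | SameAction "'t bexp \<times> 's \<times> 'p" "'t bexp \<times> 'u \<times> 'p"

definition conjuncts ::
    "('t, 's, 'p) symbolic_automaton \<Rightarrow> ('t, 'u, 'p) symbolic_automaton
      \<Rightarrow> 's \<Rightarrow> 'u \<Rightarrow> ('t, 's, 'u, 'p) conjunct set" where
  "conjuncts A B s u =
     {SameAcceptance} \<union>
     LeftRejected ` delta A s \<union>
     RightRejected ` delta B u \<union>
     {DifferentActions d e | d e. d \<in> delta A s \<and> e \<in> delta B u} \<union>
     {SameAction d e | d e. d \<in> delta A s \<and> e \<in> delta B u}"

text \<open>Everything the pseudocode leaves open: the order in which the depth-first search visits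
  successors, the order in which conjuncts are evaluated, and the choice of representatives.
  No generality is lost by letting \<open>order\<close> depend on the pair \<open>(s, u)\<close> only, nor by letting
  \<open>pick\<close> depend only on the current classes and the arguments: within one run, conjuncts are
  evaluated at most once per pair, and every proper merge changes the object.\<close>

record ('t, 's, 'u, 'p) strategy =
  succs :: "'s + 'u \<Rightarrow> ('s + 'u) list"
  order :: "'s \<Rightarrow> 'u \<Rightarrow> ('t, 's, 'u, 'p) conjunct list"
  pick :: "('s + 'u) union_find \<Rightarrow> 's + 'u \<Rightarrow> 's + 'u \<Rightarrow> 's + 'u"

definition admissible ::
    "('t, 's, 'p) symbolic_automaton \<Rightarrow> ('t, 'u, 'p) symbolic_automaton
      \<Rightarrow> ('t, 's, 'u, 'p) strategy \<Rightarrow> bool" where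
  "admissible A B \<sigma> \<longleftrightarrow>
     (\<forall>x \<in> states A <+> states B. set (succs \<sigma> x) = nonblocked A B `` {x}) \<and>
     (\<forall>s \<in> states A. \<forall>u \<in> states B.
        distinct (order \<sigma> s u) \<and> set (order \<sigma> s u) = conjuncts A B s u) \<and>
     (\<forall>rep x y. pick \<sigma> rep x y \<in> {z. rep z = rep x \<or> rep z = rep y})"

text \<open>Programs return an option; as usual for \<open>partial_function\<close>, \<open>None\<close> is the result of a
  computation that does not terminate. The search returns the set of reached states; its
  arguments are the stack and the set of states visited so far.\<close>

partial_function (option) dfs :: "('x \<Rightarrow> 'x list) \<Rightarrow> 'x list \<Rightarrow> 'x set \<Rightarrow> 'x set option" where
  "dfs next stack V =
     (case stack of
        [] \<Rightarrow> Some V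
      | x # xs \<Rightarrow> if x \<in> V then dfs next xs V else dfs next (next x @ xs) (insert x V))"

definition isdead ::
    "('t, 's, 'p) symbolic_automaton \<Rightarrow> ('t, 'u, 'p) symbolic_automaton
      \<Rightarrow> ('t, 's, 'u, 'p) strategy
      \<Rightarrow> 's + 'u \<Rightarrow> ('s + 'u) memory \<Rightarrow> (bool \<times> ('s + 'u) memory) option" where
  "isdead A B \<sigma> x m =
     (if x \<in> snd m then Some (True, m)
      else do {
        V \<leftarrow> dfs (succs \<sigma>) [x] {};
        if \<exists>y \<in> V. \<not> BigOr (eps_sum A B y) \<equiv>\<^sub>B\<^sub>A BZero then Some (False, m)
        else Some (True, (fst m, snd m \<union> V))
      })"

definition knowndead :: "'x \<Rightarrow> 'x memory \<Rightarrow> bool" where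
  "knowndead x m \<longleftrightarrow> x \<in> snd m"

text \<open>Sequential evaluation of a list of conjuncts with short-circuiting.\<close>

primrec eval_all ::
    "('c \<Rightarrow> 'm \<Rightarrow> (bool \<times> 'm) option) \<Rightarrow> 'c list \<Rightarrow> 'm \<Rightarrow> (bool \<times> 'm) option" where
  "eval_all f [] m = Some (True, m)"
| "eval_all f (c # cs) m = do {
     (r, m') \<leftarrow> f c m;
     if r then eval_all f cs m' else Some (False, m')
   }"

lemma eval_all_mono [partial_function_mono]:
  assumes "\<And>c m. mono_option (\<lambda>g. F g c m)"
  shows "mono_option (\<lambda>g. eval_all (F g) cs m)"
proof (induction cs arbitrary: m)
  case Nil
  show ?case by (simp add: option.const_mono)
next
  case (Cons c cs)
  show ?case
    by (auto intro!: bind_mono assms Cons if_mono option.const_mono split: prod.split)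
qed

text \<open>The parameters \<open>ISD\<close> and \<open>KND\<close> are the implementations of \<open>ISDEAD\<close> and
  \<open>KNOWNDEAD\<close>; \<open>EQ\<close> is the recursive call.\<close>

definition eval_conjunct ::
    "('t, 's, 'p) symbolic_automaton \<Rightarrow> ('t, 'u, 'p) symbolic_automaton
      \<Rightarrow> ('s + 'u \<Rightarrow> ('s + 'u) memory \<Rightarrow> (bool \<times> ('s + 'u) memory) option)
      \<Rightarrow> ('s \<Rightarrow> 'u \<Rightarrow> ('s + 'u) memory \<Rightarrow> (bool \<times> ('s + 'u) memory) option)
      \<Rightarrow> 's \<Rightarrow> 'u
      \<Rightarrow> ('t, 's, 'u, 'p) conjunct
      \<Rightarrow> ('s + 'u) memory \<Rightarrow> (bool \<times> ('s + 'u) memory) option" where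
  "eval_conjunct A B ISD EQ s u c m =
     (case c of
        SameAcceptance \<Rightarrow> Some (BigOr (eps A s) \<equiv>\<^sub>B\<^sub>A BigOr (eps B u), m)
      | LeftRejected (b, s', p) \<Rightarrow>
          if \<not> BAnd b (rho B u) \<equiv>\<^sub>B\<^sub>A BZero then ISD (Inl s') m else Some (True, m)
      | RightRejected (b, u', p) \<Rightarrow>
          if \<not> BAnd b (rho A s) \<equiv>\<^sub>B\<^sub>A BZero then ISD (Inr u') m else Some (True, m)
      | DifferentActions (b, s', p) (a, u', q) \<Rightarrow>
          if \<not> BAnd b a \<equiv>\<^sub>B\<^sub>A BZero \<and> p \<noteq> q then eval_all ISD [Inl s', Inr u'] m
          else Some (True, m)
      | SameAction (b, s', p) (a, u', q) \<Rightarrow>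
          if \<not> BAnd b a \<equiv>\<^sub>B\<^sub>A BZero \<and> p = q then EQ s' u' m else Some (True, m))"

lemma eval_conjunct_mono [partial_function_mono]:
  assumes "\<And>s' u' m. mono_option (\<lambda>g. E g s' u' m)"
  shows "mono_option (\<lambda>g. eval_conjunct A B ISD (E g) s u c m)"
  unfolding eval_conjunct_def
  by (cases c) (auto intro!: assms if_mono option.const_mono split: prod.splits)

partial_function (option) equiv_states ::
    "('t, 's, 'p) symbolic_automaton \<Rightarrow> ('t, 'u, 'p) symbolic_automaton
      \<Rightarrow> ('t, 's, 'u, 'p) strategy
      \<Rightarrow> ('s + 'u \<Rightarrow> ('s + 'u) memory \<Rightarrow> (bool \<times> ('s + 'u) memory) option)
      \<Rightarrow> ('s + 'u \<Rightarrow> ('s + 'u) memory \<Rightarrow> bool)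
      \<Rightarrow> 's \<Rightarrow> 'u
      \<Rightarrow> ('s + 'u) memory \<Rightarrow> (bool \<times> ('s + 'u) memory) option" where
  "equiv_states A B \<sigma> ISD KND s u m =
     (if fst m (Inl s) = fst m (Inr u) then Some (True, m)
      else let m' = (uf_union (pick \<sigma>) (Inl s) (Inr u) (fst m), snd m) in
        if KND (Inl s) m' then ISD (Inr u) m'
        else if KND (Inr u) m' then ISD (Inl s) m'
        else eval_all (eval_conjunct A B ISD (equiv_states A B \<sigma> ISD KND) s u) (order \<sigma> s u) m')"

definition terminates :: "(bool \<times> 'm) option \<Rightarrow> bool" where
  "terminates r \<longleftrightarrow> r \<noteq> None"

definition returns_true :: "(bool \<times> 'm) option \<Rightarrow> bool" where
  "returns_true r \<longleftrightarrow> (\<exists>m. r = Some (True, m))"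

end

theory Submission
  imports Defs
begin

text \<open>Both claims are instances of one analysis, parametric in a predicate \<open>D\<close> that the dead-state
  test decides (\<open>D\<close> is deadness for the first claim and constantly false for the second). Boolean
  algebra is complete for its two-valued models, so the conjuncts evaluated on a pair of states say
  that the outcomes of the pair match on each atom, modulo \<open>D\<close> and the relation holding between
  the targets of equal actions.

  Each call that is not answered at once merges two classes, which bounds the recursion. If a run
  returns true, then the pairs merged during the run match modulo the final union-find classes,
  and these classes form the least equivalence generated by those pairs; hence an equivalence
  relation that contains the merged pairs contains all pairs of equal representative. Agreement on a
  single word, by induction on the word, is such an equivalence, and so is matching modulo the final
  classes. Conversely, on a trace-equivalent (or bisimilar) pair no conjunct fails and all
  recursive calls are again on such pairs.\<close>

section \<open>Completeness of Boolean algebra\<close>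

declare ba_equiv.trans [trans]

lemma ba_equiv_sound: "b \<equiv>\<^sub>B\<^sub>A c \<Longrightarrow> satisfies \<alpha> b = satisfies \<alpha> c"
  by (induction rule: ba_equiv.induct) auto

lemma ba_And_left: "b \<equiv>\<^sub>B\<^sub>A b' \<Longrightarrow> BAnd b c \<equiv>\<^sub>B\<^sub>A BAnd b' c"
  by (intro ba_equiv.cong_And ba_equiv.refl)

lemma ba_And_right: "c \<equiv>\<^sub>B\<^sub>A c' \<Longrightarrow> BAnd b c \<equiv>\<^sub>B\<^sub>A BAnd b c'"
  by (intro ba_equiv.cong_And ba_equiv.refl)

lemma ba_Zero_Or: "BOr BZero b \<equiv>\<^sub>B\<^sub>A b"
  by (rule ba_equiv.trans[OF ba_equiv.commute_Or ba_equiv.ident_Or])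

lemma ba_And_Zero: "BAnd b BZero \<equiv>\<^sub>B\<^sub>A BZero"
proof -
  have "BAnd b BZero \<equiv>\<^sub>B\<^sub>A BAnd BZero (BOr BZero b)"
    by (meson ba_And_right ba_Zero_Or ba_equiv.commute_And ba_equiv.sym ba_equiv.trans)
  also have "BAnd BZero (BOr BZero b) \<equiv>\<^sub>B\<^sub>A BZero"
    by (rule ba_equiv.absorb_And)
  finally show ?thesis .
qed

lemma ba_Zero_And: "BAnd BZero b \<equiv>\<^sub>B\<^sub>A BZero"
  by (rule ba_equiv.trans[OF ba_equiv.commute_And ba_And_Zero])

lemma ba_And_idem: "BAnd b b \<equiv>\<^sub>B\<^sub>A b"
proof -
  have "BAnd b b \<equiv>\<^sub>B\<^sub>A BAnd b (BOr b BZero)"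
    by (intro ba_And_right ba_equiv.sym[OF ba_equiv.ident_Or])
  also have "\<dots> \<equiv>\<^sub>B\<^sub>A b" by (rule ba_equiv.absorb_And)
  finally show ?thesis .
qed

text \<open>Case distinction on \<open>c\<close> inside the algebra. When one of the two summands
  vanishes, \<open>b\<close> equals the other; \<open>ba_And_absorbed\<close> and
  \<open>ba_And_Not_absorbed\<close> are these two cases.\<close>

lemma ba_split: "b \<equiv>\<^sub>B\<^sub>A BOr (BAnd b c) (BAnd b (BNot c))"
proof -
  have "b \<equiv>\<^sub>B\<^sub>A BAnd b (BOr c (BNot c))"
    by (meson ba_And_right ba_equiv.compl_Or ba_equiv.ident_And ba_equiv.sym ba_equiv.trans)
  also have "\<dots> \<equiv>\<^sub>B\<^sub>A BOr (BAnd b c) (BAnd b (BNot c))" by (rule ba_equiv.distrib_And)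
  finally show ?thesis .
qed

lemma ba_And_absorbed: "BAnd b (BNot c) \<equiv>\<^sub>B\<^sub>A BZero \<Longrightarrow> BAnd b c \<equiv>\<^sub>B\<^sub>A b"
  by (meson ba_equiv.cong_Or ba_equiv.ident_Or ba_equiv.refl ba_equiv.sym ba_equiv.trans ba_split)

lemma ba_And_Not_absorbed: "BAnd b c \<equiv>\<^sub>B\<^sub>A BZero \<Longrightarrow> BAnd b (BNot c) \<equiv>\<^sub>B\<^sub>A b"
  by (meson ba_equiv.cong_Or ba_Zero_Or ba_equiv.refl ba_equiv.sym ba_equiv.trans ba_split)

lemma ba_And_Not_Zero:
  assumes "BAnd b c \<equiv>\<^sub>B\<^sub>A b"
  shows "BAnd b (BNot c) \<equiv>\<^sub>B\<^sub>A BZero"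
proof -
  have "BAnd b (BNot c) \<equiv>\<^sub>B\<^sub>A BAnd (BAnd b c) (BNot c)"
    by (intro ba_And_left ba_equiv.sym[OF assms])
  also have "\<dots> \<equiv>\<^sub>B\<^sub>A BAnd b (BAnd c (BNot c))" by (rule ba_equiv.assoc_And)
  also have "\<dots> \<equiv>\<^sub>B\<^sub>A BAnd b BZero" by (intro ba_And_right ba_equiv.compl_And)
  also have "\<dots> \<equiv>\<^sub>B\<^sub>A BZero" by (rule ba_And_Zero)
  finally show ?thesis .
qed

section \<open>Minterms and the completeness argument\<close>

definition literal :: "'t atom \<Rightarrow> 't \<Rightarrow> 't bexp" where
  "literal \<alpha> t = (if t \<in> \<alpha> then BTest t else BNot (BTest t))"

text \<open>Over an enumeration of all tests this is the atom of the free Boolean algebra that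
  belongs to the truth assignment \<alpha>. The tests are listed so that inductions can remove them
  one by one.\<close>

primrec minterm :: "'t atom \<Rightarrow> 't list \<Rightarrow> 't bexp" where
  "minterm \<alpha> [] = BOne"
| "minterm \<alpha> (t # ts) = BAnd (literal \<alpha> t) (minterm \<alpha> ts)"

lemma minterm_literal:
  "t \<in> set ts \<Longrightarrow> BAnd (minterm \<alpha> ts) (literal \<alpha> t) \<equiv>\<^sub>B\<^sub>A minterm \<alpha> ts"
proof (induction ts)
  case (Cons t' ts)
  let ?l = "literal \<alpha> t" and ?m = "minterm \<alpha> ts"
  show ?case
  proof (cases "t' = t")
    case True
    have "BAnd (BAnd ?l ?m) ?l \<equiv>\<^sub>B\<^sub>A BAnd ?l (BAnd ?l ?m)" by (rule ba_equiv.commute_And)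
    also have "\<dots> \<equiv>\<^sub>B\<^sub>A BAnd (BAnd ?l ?l) ?m" by (rule ba_equiv.sym[OF ba_equiv.assoc_And])
    also have "\<dots> \<equiv>\<^sub>B\<^sub>A BAnd ?l ?m" by (intro ba_And_left ba_And_idem)
    finally show ?thesis using True by simp
  next
    case False
    then have "BAnd ?m ?l \<equiv>\<^sub>B\<^sub>A ?m" using Cons by auto
    then show ?thesis
      by (auto intro: ba_equiv.trans[OF ba_equiv.assoc_And ba_And_right])
  qed
qed simp

text \<open>Induction on \<open>b\<close>: below a minterm that fixes all its tests, an expression
  can be evaluated inside the algebra, and it collapses to 1 or 0 according to its truth value under
  \<alpha>.\<close>

lemma minterm_decides:
  assumes "tests b \<subseteq> set ts"
  shows "if satisfies \<alpha> b then BAnd (minterm \<alpha> ts) b \<equiv>\<^sub>B\<^sub>A minterm \<alpha> ts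
    else BAnd (minterm \<alpha> ts) b \<equiv>\<^sub>B\<^sub>A BZero"
  using assms
proof (induction b)
  case BZero
  then show ?case by (simp add: ba_And_Zero)
next
  case BOne
  then show ?case by (simp add: ba_equiv.ident_And)
next
  case (BTest t)
  then have *: "BAnd (minterm \<alpha> ts) (literal \<alpha> t) \<equiv>\<^sub>B\<^sub>A minterm \<alpha> ts"
    by (intro minterm_literal) auto
  show ?case
  proof (cases "t \<in> \<alpha>")
    case True
    then show ?thesis using * by (simp add: literal_def)
  next
    case False
    let ?m = "minterm \<alpha> ts"
    have m: "BAnd ?m (BNot (BTest t)) \<equiv>\<^sub>B\<^sub>A ?m" using * False by (simp add: literal_def)
    have "BAnd ?m (BTest t) \<equiv>\<^sub>B\<^sub>A BAnd (BAnd ?m (BNot (BTest t))) (BTest t)"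
      by (intro ba_And_left ba_equiv.sym[OF m])
    also have "\<dots> \<equiv>\<^sub>B\<^sub>A BAnd ?m (BAnd (BNot (BTest t)) (BTest t))"
      by (rule ba_equiv.assoc_And)
    also have "\<dots> \<equiv>\<^sub>B\<^sub>A BAnd ?m BZero"
      by (intro ba_And_right ba_equiv.trans[OF ba_equiv.commute_And ba_equiv.compl_And])
    also have "\<dots> \<equiv>\<^sub>B\<^sub>A BZero" by (rule ba_And_Zero)
    finally show ?thesis using False by simp
  qed
next
  case (BAnd b c)
  let ?m = "minterm \<alpha> ts"
  have assoc: "BAnd ?m (BAnd b c) \<equiv>\<^sub>B\<^sub>A BAnd (BAnd ?m b) c"
    by (rule ba_equiv.sym[OF ba_equiv.assoc_And])
  show ?case
  proof (cases "satisfies \<alpha> b")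
    case True
    then have "BAnd ?m (BAnd b c) \<equiv>\<^sub>B\<^sub>A BAnd ?m c"
      using BAnd by (auto intro: ba_equiv.trans[OF assoc ba_And_left])
    then show ?thesis using BAnd True by (auto intro: ba_equiv.trans)
  next
    case False
    then have "BAnd ?m (BAnd b c) \<equiv>\<^sub>B\<^sub>A BAnd BZero c"
      using BAnd by (auto intro: ba_equiv.trans[OF assoc ba_And_left])
    then show ?thesis using False by (auto intro: ba_equiv.trans ba_Zero_And)
  qed
next
  case (BOr b c)
  let ?m = "minterm \<alpha> ts"
  let ?v = "\<lambda>b. if satisfies \<alpha> b then ?m else BZero"
  have "BAnd ?m (BOr b c) \<equiv>\<^sub>B\<^sub>A BOr (BAnd ?m b) (BAnd ?m c)" by (rule ba_equiv.distrib_And)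
  also have "\<dots> \<equiv>\<^sub>B\<^sub>A BOr (?v b) (?v c)"
    using BOr by (intro ba_equiv.cong_Or) (auto split: if_splits)
  also have "\<dots> \<equiv>\<^sub>B\<^sub>A ?v (BOr b c)"
  proof -
    have "BOr ?m ?m \<equiv>\<^sub>B\<^sub>A ?m"
      by (meson ba_equiv.absorb_Or ba_equiv.cong_Or ba_equiv.ident_And ba_equiv.refl
          ba_equiv.sym ba_equiv.trans)
    then show ?thesis by (auto intro: ba_Zero_Or ba_equiv.ident_Or)
  qed
  finally show ?case by (auto split: if_splits)
next
  case (BNot b)
  then show ?case by (auto intro: ba_And_Not_Zero ba_And_Not_absorbed split: if_splits)
qed

lemma minterm_cong: "(\<And>t. t \<in> set ts \<Longrightarrow> t \<in> \<alpha> \<longleftrightarrow> t \<in> \<beta>) \<Longrightarrow> minterm \<alpha> ts = minterm \<beta> ts"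
  by (induction ts) (auto simp: literal_def)

text \<open>Shannon expansion: \<open>c\<close> is split along the first test and the induction
  hypothesis is applied to both halves, which is why \<open>c\<close> is generalized. This replaces
  the fact that the disjunction of all minterms is 1.\<close>

lemma minterms_cover:
  assumes "distinct ts" and "\<And>\<alpha>. \<alpha> \<subseteq> set ts \<Longrightarrow> BAnd c (minterm \<alpha> ts) \<equiv>\<^sub>B\<^sub>A BZero"
  shows "c \<equiv>\<^sub>B\<^sub>A BZero"
  using assms
proof (induction ts arbitrary: c)
  case Nil
  have "BAnd c BOne \<equiv>\<^sub>B\<^sub>A BZero" using Nil(2)[of "{}"] by simp
  then show ?case by (meson ba_equiv.ident_And ba_equiv.sym ba_equiv.trans)
next
  case (Cons t ts)
  \<comment> \<open>The two choices of \<beta>, \<open>{t}\<close> and \<open>{}\<close>, fix the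
    value of \<open>t\<close>, and \<alpha> fixes the other tests. Since \<open>t\<close> does not
    occur in \<open>ts\<close>, the minterm of the union factors into the literal of \<beta> and the
    minterm of \<alpha>.\<close>
  have branch: "BAnd c (literal \<beta> t) \<equiv>\<^sub>B\<^sub>A BZero" if "\<beta> \<subseteq> {t}" for \<beta>
  proof (rule Cons.IH)
    fix \<alpha> assume \<alpha>: "\<alpha> \<subseteq> set ts"
    have "minterm (\<beta> \<union> \<alpha>) (t # ts) = BAnd (literal \<beta> t) (minterm \<alpha> ts)"
      using \<alpha> that Cons.prems(1) by (auto simp: literal_def intro!: minterm_cong)
    then have "BAnd c (BAnd (literal \<beta> t) (minterm \<alpha> ts)) \<equiv>\<^sub>B\<^sub>A BZero"
      using Cons.prems(2)[of "\<beta> \<union> \<alpha>"] \<alpha> that by auto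
    then show "BAnd (BAnd c (literal \<beta> t)) (minterm \<alpha> ts) \<equiv>\<^sub>B\<^sub>A BZero"
      by (rule ba_equiv.trans[OF ba_equiv.assoc_And])
  qed (use Cons.prems in simp)
  have "BAnd c (BTest t) \<equiv>\<^sub>B\<^sub>A BZero" "BAnd c (BNot (BTest t)) \<equiv>\<^sub>B\<^sub>A BZero"
    using branch[of "{t}"] branch[of "{}"] by (simp_all add: literal_def)
  then show ?case by (meson ba_And_absorbed ba_equiv.sym ba_equiv.trans)
qed

text \<open>An unsatisfiable expression is false under each assignment, so it meets every minterm in
  0, and the minterms cover everything. The converse is soundness.\<close>

lemma ba_equiv_Zero_iff:
  assumes "finite T" and "b \<in> BExp T"
  shows "b \<equiv>\<^sub>B\<^sub>A BZero \<longleftrightarrow> (\<forall>\<alpha>\<in>At T. \<not> satisfies \<alpha> b)"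
proof
  assume unsat: "\<forall>\<alpha>\<in>At T. \<not> satisfies \<alpha> b"
  obtain ts where ts: "distinct ts" "set ts = T"
    using finite_distinct_list[OF assms(1)] by auto
  show "b \<equiv>\<^sub>B\<^sub>A BZero"
  proof (rule minterms_cover[OF ts(1)])
    fix \<alpha> assume "\<alpha> \<subseteq> set ts"
    then have "BAnd (minterm \<alpha> ts) b \<equiv>\<^sub>B\<^sub>A BZero"
      using minterm_decides[of b ts \<alpha>] assms(2) ts unsat by (auto simp: BExp_def At_def)
    then show "BAnd b (minterm \<alpha> ts) \<equiv>\<^sub>B\<^sub>A BZero"
      by (rule ba_equiv.trans[OF ba_equiv.commute_And])
  qed
qed (auto dest: ba_equiv_sound)

text \<open>Reduction to the case of 0: if both differences of \<open>b\<close> and \<open>c\<close>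
  vanish, then each of the two equals their conjunction.\<close>

lemma ba_equiv_iff:
  assumes "finite T" and "b \<in> BExp T" and "c \<in> BExp T"
  shows "b \<equiv>\<^sub>B\<^sub>A c \<longleftrightarrow> (\<forall>\<alpha>\<in>At T. satisfies \<alpha> b = satisfies \<alpha> c)"
proof
  assume eq: "\<forall>\<alpha>\<in>At T. satisfies \<alpha> b = satisfies \<alpha> c"
  have "BAnd b (BNot c) \<equiv>\<^sub>B\<^sub>A BZero" "BAnd c (BNot b) \<equiv>\<^sub>B\<^sub>A BZero"
    using assms eq by (auto simp: ba_equiv_Zero_iff[OF assms(1)] BExp_def)
  then show "b \<equiv>\<^sub>B\<^sub>A c"
    by (meson ba_And_absorbed ba_equiv.commute_And ba_equiv.sym ba_equiv.trans)
qed (auto dest: ba_equiv_sound)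

section \<open>Finite conjunctions and disjunctions over the tests\<close>

lemma BExp_simps [simp]:
  "BZero \<in> BExp T" "BOne \<in> BExp T"
  "BAnd b c \<in> BExp T \<longleftrightarrow> b \<in> BExp T \<and> c \<in> BExp T"
  "BOr b c \<in> BExp T \<longleftrightarrow> b \<in> BExp T \<and> c \<in> BExp T"
  "BNot b \<in> BExp T \<longleftrightarrow> b \<in> BExp T"
  by (auto simp: BExp_def)

lemma set_enumeration: "finite X \<Longrightarrow> set (enumeration X) = X"
  unfolding enumeration_def by (rule someI2_ex) (auto dest: finite_distinct_list)

lemma satisfies_BigOr: "finite X \<Longrightarrow> satisfies \<alpha> (BigOr X) \<longleftrightarrow> (\<exists>b\<in>X. satisfies \<alpha> b)"
proof -
  have "satisfies \<alpha> (foldr BOr xs BZero) \<longleftrightarrow> (\<exists>b\<in>set xs. satisfies \<alpha> b)" for xs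
    by (induction xs) auto
  then show "finite X \<Longrightarrow> ?thesis" by (simp add: BigOr_def set_enumeration)
qed

lemma satisfies_BigAnd: "finite X \<Longrightarrow> satisfies \<alpha> (BigAnd X) \<longleftrightarrow> (\<forall>b\<in>X. satisfies \<alpha> b)"
proof -
  have "satisfies \<alpha> (foldr BAnd xs BOne) \<longleftrightarrow> (\<forall>b\<in>set xs. satisfies \<alpha> b)" for xs
    by (induction xs) auto
  then show "finite X \<Longrightarrow> ?thesis" by (simp add: BigAnd_def set_enumeration)
qed

lemma BigOr_BExp: "finite X \<Longrightarrow> X \<subseteq> BExp T \<Longrightarrow> BigOr X \<in> BExp T"
proof -
  have "set xs \<subseteq> BExp T \<Longrightarrow> foldr BOr xs BZero \<in> BExp T" for xs by (induction xs) auto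
  then show "finite X \<Longrightarrow> X \<subseteq> BExp T \<Longrightarrow> ?thesis" by (simp add: BigOr_def set_enumeration)
qed

lemma BigAnd_BExp: "finite X \<Longrightarrow> X \<subseteq> BExp T \<Longrightarrow> BigAnd X \<in> BExp T"
proof -
  have "set xs \<subseteq> BExp T \<Longrightarrow> foldr BAnd xs BOne \<in> BExp T" for xs by (induction xs) auto
  then show "finite X \<Longrightarrow> X \<subseteq> BExp T \<Longrightarrow> ?thesis" by (simp add: BigAnd_def set_enumeration)
qed


section \<open>The concretization\<close>

locale finite_symbolic =
  fixes T :: "'t set" and \<Sigma> :: "'p set" and A :: "('t, 's, 'p) symbolic_automaton"
  assumes finite_tests: "finite T" and finite_symbolic: "finite_symbolic_gkat T \<Sigma> A"
begin

abbreviation "Z \<equiv> zeta (concretization A)"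

lemma finite_eps: "s \<in> states A \<Longrightarrow> finite (eps A s)"
  and finite_delta: "s \<in> states A \<Longrightarrow> finite (delta A s)"
  and eps_BExp: "s \<in> states A \<Longrightarrow> eps A s \<subseteq> BExp T"
  using finite_symbolic by (auto simp: finite_symbolic_gkat_def symbolic_gkat_def)

lemma deltaD:
  assumes "(b, s', p) \<in> delta A s" and "s \<in> states A"
  shows "b \<in> BExp T" and "s' \<in> states A"
proof -
  have "delta A s \<subseteq> BExp T \<times> states A \<times> \<Sigma>"
    using finite_symbolic assms(2) unfolding finite_symbolic_gkat_def symbolic_gkat_def by blast
  then show "b \<in> BExp T" "s' \<in> states A" using assms(1) by auto
qed

lemma guards_disjoint:
  assumes "s \<in> states A" "e \<in> eps A s <+> delta A s" "f \<in> eps A s <+> delta A s"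
    and "satisfies \<alpha> (guard e)" "satisfies \<alpha> (guard f)"
  shows "e = f"
proof (rule ccontr)
  assume "e \<noteq> f"
  then have "BAnd (guard e) (guard f) \<equiv>\<^sub>B\<^sub>A BZero"
    using assms finite_symbolic unfolding finite_symbolic_gkat_def symbolic_gkat_def by blast
  from ba_equiv_sound[OF this, of \<alpha>] show False using assms by simp
qed

lemma eps_delta_disjoint:
  assumes "s \<in> states A" "b \<in> eps A s" "satisfies \<alpha> b" "(c, s', p) \<in> delta A s"
  shows "\<not> satisfies \<alpha> c"
  using guards_disjoint[of s "Inl b" "Inr (c, s', p)" \<alpha>] assms by (auto simp: guard_def)

lemma delta_unique:
  assumes "s \<in> states A" "(b, x, p) \<in> delta A s" "satisfies \<alpha> b"
    and "(c, y, q) \<in> delta A s" "satisfies \<alpha> c"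
  shows "x = y \<and> p = q"
  using guards_disjoint[of s "Inr (b, x, p)" "Inr (c, y, q)" \<alpha>] assms by (auto simp: guard_def)

lemma zeta_Accept: "Z s \<alpha> = Accept \<longleftrightarrow> (\<exists>b\<in>eps A s. satisfies \<alpha> b)"
  by (auto simp: concretization_def split: prod.split)

lemma zeta_StepI:
  assumes "s \<in> states A" "(b, s', p) \<in> delta A s" "satisfies \<alpha> b"
  shows "Z s \<alpha> = Step s' p"
proof -
  \<comment> \<open>The description is well defined by \<open>delta_unique\<close>. The other half
    of disjointedness, \<open>eps_delta_disjoint\<close>, then rules out the accepting branch of the
    definition.\<close>
  have "(THE (s', p). \<exists>b. (b, s', p) \<in> delta A s \<and> satisfies \<alpha> b) = (s', p)"
    using assms by (intro the_equality) (auto dest: delta_unique)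
  then show ?thesis
    using assms eps_delta_disjoint[OF assms(1) _ _ assms(2), of _ \<alpha>]
    by (auto simp: concretization_def)
qed

lemma zeta_Step:
  assumes "s \<in> states A"
  shows "Z s \<alpha> = Step s' p \<longleftrightarrow> (\<exists>b. (b, s', p) \<in> delta A s \<and> satisfies \<alpha> b)"
proof
  assume step: "Z s \<alpha> = Step s' p"
  then have "\<exists>(b, x, q)\<in>delta A s. satisfies \<alpha> b"
    by (auto simp: concretization_def split: if_splits)
  then obtain b x q where bxq: "(b, x, q) \<in> delta A s" "satisfies \<alpha> b" by auto
  with zeta_StepI[OF assms this] step show "\<exists>b. (b, s', p) \<in> delta A s \<and> satisfies \<alpha> b" by auto
qed (auto intro: zeta_StepI[OF assms])

lemma finite_rho_conjuncts:
  assumes "s \<in> states A"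
  shows "finite ({BNot b | b. b \<in> eps A s} \<union> {BNot b | b s' p. (b, s', p) \<in> delta A s})"
proof -
  have "{BNot b | b s' p. (b, s', p) \<in> delta A s} = (\<lambda>(b, _). BNot b) ` delta A s"
    by force
  then show ?thesis using finite_eps[OF assms] finite_delta[OF assms] by simp
qed

lemma rho_BExp: "s \<in> states A \<Longrightarrow> rho A s \<in> BExp T"
  unfolding rho_def using eps_BExp[of s]
  by (intro BigAnd_BExp finite_rho_conjuncts) (auto dest: deltaD(1))

text \<open>The conjuncts of \<open>rho\<close> negate exactly the guards that would let \<alpha> be
  accepted or trigger a transition, and rejection is the only outcome left.\<close>

lemma zeta_Reject:
  assumes "s \<in> states A"
  shows "Z s \<alpha> = Reject \<longleftrightarrow> satisfies \<alpha> (rho A s)"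
proof -
  have "satisfies \<alpha> (rho A s) \<longleftrightarrow> Z s \<alpha> \<noteq> Accept \<and> (\<forall>s' p. Z s \<alpha> \<noteq> Step s' p)"
    unfolding rho_def satisfies_BigAnd[OF finite_rho_conjuncts[OF assms]] zeta_Accept
      zeta_Step[OF assms] ball_Un Ball_def mem_Collect_eq
    by auto (metis satisfies.simps(6))
  then show ?thesis by (cases "Z s \<alpha>") auto
qed

lemma zeta_state: "s \<in> states A \<Longrightarrow> Z s \<alpha> = Step s' p \<Longrightarrow> s' \<in> states A"
  by (auto simp: zeta_Step dest: deltaD)

lemma BigOr_eps_Zero_iff:
  assumes "s \<in> states A"
  shows "BigOr (eps A s) \<equiv>\<^sub>B\<^sub>A BZero \<longleftrightarrow> (\<forall>\<alpha>\<in>At T. Z s \<alpha> \<noteq> Accept)"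
  by (simp add: ba_equiv_Zero_iff[OF finite_tests BigOr_BExp] finite_eps eps_BExp assms
      satisfies_BigOr zeta_Accept)

text \<open>By completeness a guard that is not derivably 0 is satisfied by some atom, and this atom
  prolongs any trace of the target.\<close>

lemma nonempty_traces_step:
  assumes "s \<in> states A" "(b, s', p) \<in> delta A s" "\<not> b \<equiv>\<^sub>B\<^sub>A BZero"
    and "traces T (concretization A) s' \<noteq> {}"
  shows "traces T (concretization A) s \<noteq> {}"
proof -
  obtain \<alpha> where "\<alpha> \<in> At T" "satisfies \<alpha> b"
    using assms deltaD[OF assms(2,1)] by (auto simp: ba_equiv_Zero_iff[OF finite_tests])
  then show ?thesis
    using assms(4) zeta_StepI[OF assms(1,2)] by (fastforce simp: traces_def intro: is_trace.step)
qed

text \<open>The part of \<open>nonblocked\<close> that belongs to one automaton. Searches in the sum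
  never leave the side on which they start, so deadness can be studied here.\<close>

definition live :: "('s \<times> 's) set" where
  "live = {(x, x'). \<exists>b p. (b, x', p) \<in> delta A x \<and> \<not> b \<equiv>\<^sub>B\<^sub>A BZero}"

text \<open>An accepting atom at a reachable state is carried back along the path to a trace of
  \<open>s\<close>; conversely, following a trace leads along non-blocked transitions to a state
  with an accepting atom.\<close>

lemma traces_empty_iff:
  assumes "s \<in> states A"
  shows "traces T (concretization A) s = {} \<longleftrightarrow>
    (\<forall>x. (s, x) \<in> live\<^sup>* \<longrightarrow> BigOr (eps A x) \<equiv>\<^sub>B\<^sub>A BZero)"
proof (intro iffI allI impI)
  fix x assume empty: "traces T (concretization A) s = {}" and "(s, x) \<in> live\<^sup>*"
  show "BigOr (eps A x) \<equiv>\<^sub>B\<^sub>A BZero"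
  proof (rule ccontr)
    assume nz: "\<not> BigOr (eps A x) \<equiv>\<^sub>B\<^sub>A BZero"
    \<comment> \<open>The induction runs backwards from \<open>x\<close>, whereas membership in
      \<open>states A\<close> propagates forwards from \<open>s\<close>; it is therefore a premise
      inside the induction formula.\<close>
    have "s \<in> states A \<longrightarrow> traces T (concretization A) s \<noteq> {}"
      using \<open>(s, x) \<in> live\<^sup>*\<close>
    proof (induction rule: converse_rtrancl_induct)
      case base
      show ?case
        using nz BigOr_eps_Zero_iff[of x] by (auto simp: traces_def intro: is_trace.accept)
    next
      case (step y z)
      then show ?case
        by (auto simp: live_def dest: deltaD(2) nonempty_traces_step)
    qed
    then show False using empty assms by simp
  qed
next
  assume blocked: "\<forall>x. (s, x) \<in> live\<^sup>* \<longrightarrow> BigOr (eps A x) \<equiv>\<^sub>B\<^sub>A BZero"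
  have "\<exists>x. (s, x) \<in> live\<^sup>* \<and> \<not> BigOr (eps A x) \<equiv>\<^sub>B\<^sub>A BZero"
    if "is_trace T (concretization A) s w" for w
    using that assms
  proof (induction rule: is_trace.induct)
    case (accept \<alpha> s)
    then show ?case using BigOr_eps_Zero_iff by blast
  next
    case (step \<alpha> s s' p w)
    then obtain b where b: "(b, s', p) \<in> delta A s" "satisfies \<alpha> b" by (auto simp: zeta_Step)
    then have "\<not> b \<equiv>\<^sub>B\<^sub>A BZero" by (auto dest: ba_equiv_sound)
    then have "(s, s') \<in> live" using b by (auto simp: live_def)
    then show ?case using step zeta_state by (meson converse_rtrancl_into_rtrancl)
  qed
  with blocked show "traces T (concretization A) s = {}" by (auto simp: traces_def)
qed

end


section \<open>Depth-first search\<close>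

text \<open>The result is described as a least closed set. Its closure is conditional on the loop
  invariant that successors of visited states are visited or on the stack; minimality holds since
  only successors are ever pushed.\<close>

lemma dfs_spec:
  assumes "finite D" and "\<And>x. x \<in> D \<Longrightarrow> set (succ x) \<subseteq> D"
    and "set stack \<subseteq> D" and "V \<subseteq> D"
  shows "\<exists>W. dfs succ stack V = Some W \<and> V \<union> set stack \<subseteq> W \<and>
    ((\<forall>y\<in>V. set (succ y) \<subseteq> V \<union> set stack) \<longrightarrow> (\<forall>y\<in>W. set (succ y) \<subseteq> W)) \<and>
    (\<forall>X. V \<union> set stack \<subseteq> X \<longrightarrow> (\<forall>y\<in>X. set (succ y) \<subseteq> X) \<longrightarrow> W \<subseteq> X)"
  using assms(3,4)
\<comment> \<open>Lexicographic termination: a new visit lowers the number of unvisited states,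
  which is the outer induction; skipping a visited state shortens the stack, which is the inner
  one.\<close>
proof (induction "card (D - V)" arbitrary: V stack rule: less_induct)
  case less
  note outer = less.hyps
  from less.prems show ?case
  proof (induction stack)
    case Nil
    then show ?case by (subst dfs.simps) auto
  next
    case (Cons x xs)
    show ?case
    proof (cases "x \<in> V")
      case True
      then have *: "dfs succ (x # xs) V = dfs succ xs V" by (subst dfs.simps) simp
      show ?thesis using Cons True unfolding * by (simp add: insert_absorb)
    next
      case False
      then have *: "dfs succ (x # xs) V = dfs succ (succ x @ xs) (insert x V)"
        by (subst dfs.simps) simp
      have "card (D - insert x V) < card (D - V)"
        using False Cons.prems assms(1) by (intro psubset_card_mono) auto
      from outer[OF this, of "succ x @ xs"] assms(2)[of x] Cons.prems
      obtain W where W: "dfs succ (succ x @ xs) (insert x V) = Some W"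
        "insert x V \<union> set (succ x @ xs) \<subseteq> W"
        "(\<forall>y\<in>insert x V. set (succ y) \<subseteq> insert x V \<union> set (succ x @ xs)) \<longrightarrow>
          (\<forall>y\<in>W. set (succ y) \<subseteq> W)"
        "\<forall>X. insert x V \<union> set (succ x @ xs) \<subseteq> X \<longrightarrow> (\<forall>y\<in>X. set (succ y) \<subseteq> X) \<longrightarrow> W \<subseteq> X"
        by auto
      show ?thesis
      proof (intro exI[of _ W] conjI impI allI)
        show "dfs succ (x # xs) V = Some W" using * W(1) by simp
        show "V \<union> set (x # xs) \<subseteq> W" using W(2) by auto
        show "\<forall>y\<in>W. set (succ y) \<subseteq> W"
          if "\<forall>y\<in>V. set (succ y) \<subseteq> V \<union> set (x # xs)"
        proof -
          have "\<forall>y\<in>insert x V. set (succ y) \<subseteq> insert x V \<union> set (succ x @ xs)"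
            using that by fastforce
          with W(3) show ?thesis by blast
        qed
        show "W \<subseteq> X"
          if "V \<union> set (x # xs) \<subseteq> X" "\<forall>y\<in>X. set (succ y) \<subseteq> X" for X
        proof -
          have "insert x V \<union> set (succ x @ xs) \<subseteq> X" using that by auto
          with W(4) that(2) show ?thesis by blast
        qed
      qed
    qed
  qed
qed

text \<open>Both sides are the least successor-closed set containing \<open>x\<close>. Starting with
  no visited state makes the loop invariant of the search vacuous.\<close>

lemma dfs_reachable:
  assumes "finite D" and "\<And>x. x \<in> D \<Longrightarrow> set (succ x) = r `` {x}" and "r `` D \<subseteq> D" and "x \<in> D"
  shows "dfs succ [x] {} = Some (r\<^sup>* `` {x})"
proof -
  have "set (succ y) \<subseteq> D" if "y \<in> D" for y using assms(2,3) that by auto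
  from dfs_spec[where succ = succ, OF assms(1) this, of "[x]" "{}"] obtain W where
    W: "dfs succ [x] {} = Some W" "x \<in> W" "\<forall>y\<in>W. set (succ y) \<subseteq> W"
    and least: "\<And>X. x \<in> X \<Longrightarrow> (\<forall>y\<in>X. set (succ y) \<subseteq> X) \<Longrightarrow> W \<subseteq> X"
    using assms(4) by auto
  have reach_D: "r\<^sup>* `` {x} \<subseteq> D"
  proof
    fix y assume "y \<in> r\<^sup>* `` {x}"
    then have "(x, y) \<in> r\<^sup>*" by simp
    then show "y \<in> D" using assms(3,4) by (induction rule: rtrancl_induct) auto
  qed
  have "W \<subseteq> r\<^sup>* `` {x}"
  proof (rule least)
    show "\<forall>y\<in>r\<^sup>* `` {x}. set (succ y) \<subseteq> r\<^sup>* `` {x}"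
    proof (intro ballI subsetI)
      fix y z assume y: "y \<in> r\<^sup>* `` {x}" and z: "z \<in> set (succ y)"
      then have "(y, z) \<in> r" using assms(2) reach_D by blast
      with y show "z \<in> r\<^sup>* `` {x}" by (auto intro: rtrancl_into_rtrancl)
    qed
  qed simp
  moreover have "r\<^sup>* `` {x} \<subseteq> W"
  proof
    fix y assume "y \<in> r\<^sup>* `` {x}"
    then have "(x, y) \<in> r\<^sup>*" by simp
    then show "y \<in> W"
    proof (induction rule: rtrancl_induct)
      case (step y z)
      then have "y \<in> D" using reach_D by auto
      then show ?case using step W(3) assms(2) by blast
    qed (use W in simp)
  qed
  ultimately show ?thesis using W(1) by simp
qed


section \<open>Union-find objects and sequential evaluation\<close>

text \<open>Each representative lies in the class that it represents. This prevents a merged class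
  from receiving the representative of a third class, which would identify too much.\<close>

definition valid_rep :: "'x union_find \<Rightarrow> bool" where
  "valid_rep rep \<longleftrightarrow> (\<forall>z. rep (rep z) = rep z)"

lemma uf_union_merges: "uf_union pk x y rep x = uf_union pk x y rep y"
  by (simp add: uf_union_def)

lemma uf_union_mono: "rep z = rep w \<Longrightarrow> uf_union pk x y rep z = uf_union pk x y rep w"
  by (simp add: uf_union_def)

lemma valid_rep_union:
  assumes "valid_rep rep" "rep (pk rep x y) \<in> {rep x, rep y}"
  shows "valid_rep (uf_union pk x y rep)"
  using assms by (auto simp: valid_rep_def uf_union_def)

text \<open>Two elements with equal new representative are either both in the merged class, and then
  related through \<open>x\<close>, or both outside, and then they were equivalent before.\<close>

lemma uf_union_least:
  assumes "valid_rep rep" "rep (pk rep x y) \<in> {rep x, rep y}"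
    and "equivp Q" "\<And>z w. rep z = rep w \<Longrightarrow> Q z w" "Q x y"
    and "uf_union pk x y rep z = uf_union pk x y rep w"
  shows "Q z w"
proof -
  let ?merged = "\<lambda>z. rep z = rep x \<or> rep z = rep y"
  have "Q z x" if "?merged z" for z
    using that assms(3-5) by (metis equivp_symp equivp_transp)
  \<comment> \<open>If \<open>b\<close> were outside, its old representative would be the picked
    element; that element lies in the class of \<open>x\<close> or \<open>y\<close>, so by
    idempotence \<open>b\<close> would too.\<close>
  moreover have "?merged b"
    if "uf_union pk x y rep a = uf_union pk x y rep b" and "?merged a" for a b
  proof (rule ccontr)
    assume "\<not> ?merged b"
    then have "pk rep x y = rep b" using that by (simp add: uf_union_def)
    then have "rep (pk rep x y) = rep b" using assms(1) by (simp add: valid_rep_def)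
    then show False using assms(2) \<open>\<not> ?merged b\<close> by auto
  qed
  then have "?merged z \<longleftrightarrow> ?merged w" using assms(6) by metis
  moreover have "rep z = rep w" if "\<not> ?merged z" "\<not> ?merged w"
    using that assms(6) by (simp add: uf_union_def)
  ultimately show ?thesis using assms(3,4) by (metis equivp_symp equivp_transp)
qed

text \<open>\<open>J\<close> is an invariant of the memory, \<open>E\<close> a preorder of memory
  growth, \<open>P c\<close> what the success of \<open>c\<close> establishes, and
  \<open>h c\<close> a condition that forces success. \<open>P\<close> must be stable under
  \<open>E\<close> because later conjuncts change the memory. After a failure nothing is claimed
  about the memory, since short-circuiting ends the evaluation.\<close>

lemma eval_all_spec:
  assumes "\<And>c m. c \<in> set cs \<Longrightarrow> J m \<Longrightarrow> \<exists>r m'. f c m = Some (r, m') \<and>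
      (r \<longrightarrow> J m' \<and> E m m' \<and> P c m') \<and> (h c \<longrightarrow> r)"
    and "\<And>m. E m m" and "\<And>l m n. E l m \<Longrightarrow> E m n \<Longrightarrow> E l n"
    and "\<And>c m m'. E m m' \<Longrightarrow> P c m \<Longrightarrow> P c m'"
    and "J m"
  shows "\<exists>r m'. eval_all f cs m = Some (r, m') \<and>
      (r \<longrightarrow> J m' \<and> E m m' \<and> (\<forall>c\<in>set cs. P c m')) \<and> ((\<forall>c\<in>set cs. h c) \<longrightarrow> r)"
  using assms(1,5)
proof (induction cs arbitrary: m)
  case Nil
  show ?case using Nil(2) assms(2) by (intro exI[of _ True] exI[of _ m]) simp
next
  case (Cons c cs)
  obtain r m' where c: "f c m = Some (r, m')" "r \<Longrightarrow> J m' \<and> E m m' \<and> P c m'" "h c \<Longrightarrow> r"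
    using Cons.prems(1)[of c m] Cons.prems(2) by auto
  show ?case
  proof (cases r)
    case True
    obtain r' m'' where cs: "eval_all f cs m' = Some (r', m'')"
      "r' \<Longrightarrow> J m'' \<and> E m' m'' \<and> (\<forall>c\<in>set cs. P c m'')" "(\<forall>c\<in>set cs. h c) \<longrightarrow> r'"
      using Cons.IH[of m'] Cons.prems(1) c(2) True by auto
    have "eval_all f (c # cs) m = Some (r', m'')" using c(1) True cs(1) by simp
    then show ?thesis using c(2) True cs(2,3) assms(3,4) by (metis set_ConsD list.set_intros(2))
  next
    case False
    then show ?thesis using c by auto
  qed
qed


section \<open>The decision procedure\<close>

text \<open>The one-step condition on a pair of outcomes: steps without a counterpart of the same
  action are tolerated if their targets satisfy \<open>D\<close>. For \<open>D\<close> constantly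
  false this is the one-step clause of bisimulations.\<close>

fun matches ::
    "('s + 'u \<Rightarrow> bool) \<Rightarrow> ('s \<Rightarrow> 'u \<Rightarrow> bool) \<Rightarrow> ('s, 'p) outcome \<Rightarrow> ('u, 'p) outcome \<Rightarrow> bool" where
  "matches D H Accept Accept = True"
| "matches D H Reject Reject = True"
| "matches D H (Step x p) Reject = D (Inl x)"
| "matches D H Reject (Step y q) = D (Inr y)"
| "matches D H (Step x p) (Step y q) = (if p = q then H x y else D (Inl x) \<and> D (Inr y))"
| "matches D H _ _ = False"

text \<open>The memory-free meaning of \<open>eval_conjunct\<close>: \<open>D\<close> stands for the
  dead-state test and \<open>H\<close> for the recursive call. In the soundness argument
  \<open>H\<close> is equality of final classes, in the completeness argument it is the semantic
  equivalence.\<close>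

definition conjunct_holds ::
    "('t, 's, 'p) symbolic_automaton \<Rightarrow> ('t, 'u, 'p) symbolic_automaton
      \<Rightarrow> ('s + 'u \<Rightarrow> bool) \<Rightarrow> ('s \<Rightarrow> 'u \<Rightarrow> bool) \<Rightarrow> 's \<Rightarrow> 'u
      \<Rightarrow> ('t, 's, 'u, 'p) conjunct \<Rightarrow> bool" where
  "conjunct_holds A B D H s u c =
     (case c of
        SameAcceptance \<Rightarrow> BigOr (eps A s) \<equiv>\<^sub>B\<^sub>A BigOr (eps B u)
      | LeftRejected (b, s', p) \<Rightarrow> \<not> BAnd b (rho B u) \<equiv>\<^sub>B\<^sub>A BZero \<longrightarrow> D (Inl s')
      | RightRejected (b, u', p) \<Rightarrow> \<not> BAnd b (rho A s) \<equiv>\<^sub>B\<^sub>A BZero \<longrightarrow> D (Inr u')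
      | DifferentActions (b, s', p) (a, u', q) \<Rightarrow>
          \<not> BAnd b a \<equiv>\<^sub>B\<^sub>A BZero \<and> p \<noteq> q \<longrightarrow> D (Inl s') \<and> D (Inr u')
      | SameAction (b, s', p) (a, u', q) \<Rightarrow> \<not> BAnd b a \<equiv>\<^sub>B\<^sub>A BZero \<and> p = q \<longrightarrow> H s' u')"

locale symbolic_pair =
  A: finite_symbolic T \<Sigma> A + B: finite_symbolic T \<Sigma> B
  for T :: "'t set" and \<Sigma> :: "'p set" and A :: "('t, 's, 'p) symbolic_automaton"
    and B :: "('t, 'u, 'p) symbolic_automaton" +
  fixes \<sigma> :: "('t, 's, 'u, 'p) strategy"
  assumes admissible: "admissible A B \<sigma>"
begin

lemma ba_nonzero_iff:
  "b \<in> BExp T \<Longrightarrow> \<not> b \<equiv>\<^sub>B\<^sub>A BZero \<longleftrightarrow> (\<exists>\<alpha>\<in>At T. satisfies \<alpha> b)"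
  by (simp add: ba_equiv_Zero_iff[OF A.finite_tests])

section \<open>Dead states as states without traces\<close>

lemma nonblocked_Inl: "(Inl x, z) \<in> nonblocked A B \<longleftrightarrow> (\<exists>x'. z = Inl x' \<and> (x, x') \<in> A.live)"
  by (auto simp: nonblocked_def A.live_def)

lemma nonblocked_Inr: "(Inr y, z) \<in> nonblocked A B \<longleftrightarrow> (\<exists>y'. z = Inr y' \<and> (y, y') \<in> B.live)"
  by (auto simp: nonblocked_def B.live_def)

lemma Inl_reachable: "(Inl x, z) \<in> (nonblocked A B)\<^sup>* \<longleftrightarrow> (\<exists>x'. z = Inl x' \<and> (x, x') \<in> A.live\<^sup>*)"
proof
  assume "(Inl x, z) \<in> (nonblocked A B)\<^sup>*"
  then show "\<exists>x'. z = Inl x' \<and> (x, x') \<in> A.live\<^sup>*"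
    by (induction rule: rtrancl_induct)
      (auto simp: nonblocked_Inl intro: rtrancl_into_rtrancl)
next
  have "(Inl x, Inl x') \<in> (nonblocked A B)\<^sup>*" if "(x, x') \<in> A.live\<^sup>*" for x'
    using that by (induction rule: rtrancl_induct)
      (auto simp: nonblocked_Inl intro: rtrancl_into_rtrancl)
  then show "\<exists>x'. z = Inl x' \<and> (x, x') \<in> A.live\<^sup>* \<Longrightarrow> (Inl x, z) \<in> (nonblocked A B)\<^sup>*" by auto
qed

lemma Inr_reachable: "(Inr y, z) \<in> (nonblocked A B)\<^sup>* \<longleftrightarrow> (\<exists>y'. z = Inr y' \<and> (y, y') \<in> B.live\<^sup>*)"
proof
  assume "(Inr y, z) \<in> (nonblocked A B)\<^sup>*"
  then show "\<exists>y'. z = Inr y' \<and> (y, y') \<in> B.live\<^sup>*"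
    by (induction rule: rtrancl_induct)
      (auto simp: nonblocked_Inr intro: rtrancl_into_rtrancl)
next
  have "(Inr y, Inr y') \<in> (nonblocked A B)\<^sup>*" if "(y, y') \<in> B.live\<^sup>*" for y'
    using that by (induction rule: rtrancl_induct)
      (auto simp: nonblocked_Inr intro: rtrancl_into_rtrancl)
  then show "\<exists>y'. z = Inr y' \<and> (y, y') \<in> B.live\<^sup>* \<Longrightarrow> (Inr y, z) \<in> (nonblocked A B)\<^sup>*" by auto
qed

lemma dead_Inl: "x \<in> states A \<Longrightarrow> dead A B (Inl x) \<longleftrightarrow> traces T (concretization A) x = {}"
  by (auto simp: dead_def Inl_reachable A.traces_empty_iff eps_sum_def)

lemma dead_Inr: "y \<in> states B \<Longrightarrow> dead A B (Inr y) \<longleftrightarrow> traces T (concretization B) y = {}"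
  by (auto simp: dead_def Inr_reachable B.traces_empty_iff eps_sum_def)

section \<open>From conjuncts on guards to outcomes on atoms\<close>

lemma all_conjuncts_iff:
  "(\<forall>c\<in>conjuncts A B s u. P c) \<longleftrightarrow> P SameAcceptance \<and>
    (\<forall>b x p. (b, x, p) \<in> delta A s \<longrightarrow> P (LeftRejected (b, x, p))) \<and>
    (\<forall>a y q. (a, y, q) \<in> delta B u \<longrightarrow> P (RightRejected (a, y, q))) \<and>
    (\<forall>b x p a y q. (b, x, p) \<in> delta A s \<longrightarrow> (a, y, q) \<in> delta B u \<longrightarrow>
      P (DifferentActions (b, x, p) (a, y, q)) \<and> P (SameAction (b, x, p) (a, y, q)))"
  unfolding conjuncts_def by (auto simp: ball_Un)

text \<open>By completeness every Boolean test in a conjunct asks whether some atom satisfies the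
  guards involved, and such an atom determines the outcomes on both sides. Exchanging the
  quantifiers over transitions and atoms then gives a condition on each atom.\<close>

lemma conjuncts_hold_iff:
  assumes s: "s \<in> states A" and u: "u \<in> states B"
  shows "(\<forall>c\<in>conjuncts A B s u. conjunct_holds A B D H s u c) \<longleftrightarrow>
    (\<forall>\<alpha>\<in>At T. matches D H (A.Z s \<alpha>) (B.Z u \<alpha>))"
proof -
  have same: "BigOr (eps A s) \<equiv>\<^sub>B\<^sub>A BigOr (eps B u) \<longleftrightarrow>
      (\<forall>\<alpha>\<in>At T. A.Z s \<alpha> = Accept \<longleftrightarrow> B.Z u \<alpha> = Accept)"
    by (subst ba_equiv_iff[OF A.finite_tests])
      (simp_all add: BigOr_BExp satisfies_BigOr A.finite_eps A.eps_BExp B.finite_eps B.eps_BExp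
        s u A.zeta_Accept B.zeta_Accept)
  have left: "\<not> BAnd b (rho B u) \<equiv>\<^sub>B\<^sub>A BZero \<longleftrightarrow> (\<exists>\<alpha>\<in>At T. satisfies \<alpha> b \<and> B.Z u \<alpha> = Reject)"
    if "(b, x, p) \<in> delta A s" for b x p
    using A.deltaD[OF that s] B.rho_BExp[OF u]
    by (subst ba_nonzero_iff) (simp_all add: B.zeta_Reject[OF u])
  have right: "\<not> BAnd b (rho A s) \<equiv>\<^sub>B\<^sub>A BZero \<longleftrightarrow> (\<exists>\<alpha>\<in>At T. satisfies \<alpha> b \<and> A.Z s \<alpha> = Reject)"
    if "(b, y, q) \<in> delta B u" for b y q
    using B.deltaD[OF that u] A.rho_BExp[OF s]
    by (subst ba_nonzero_iff) (simp_all add: A.zeta_Reject[OF s])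
  have both: "\<not> BAnd b a \<equiv>\<^sub>B\<^sub>A BZero \<longleftrightarrow> (\<exists>\<alpha>\<in>At T. satisfies \<alpha> b \<and> satisfies \<alpha> a)"
    if "(b, x, p) \<in> delta A s" "(a, y, q) \<in> delta B u" for b x p a y q
    using A.deltaD[OF that(1) s] B.deltaD[OF that(2) u]
    by (subst ba_nonzero_iff) simp_all
  have "(\<forall>c\<in>conjuncts A B s u. conjunct_holds A B D H s u c) \<longleftrightarrow>
      (\<forall>\<alpha>\<in>At T. A.Z s \<alpha> = Accept \<longleftrightarrow> B.Z u \<alpha> = Accept) \<and>
      (\<forall>\<alpha>\<in>At T. \<forall>x p. A.Z s \<alpha> = Step x p \<longrightarrow> B.Z u \<alpha> = Reject \<longrightarrow> D (Inl x)) \<and>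
      (\<forall>\<alpha>\<in>At T. \<forall>y q. B.Z u \<alpha> = Step y q \<longrightarrow> A.Z s \<alpha> = Reject \<longrightarrow> D (Inr y)) \<and>
      (\<forall>\<alpha>\<in>At T. \<forall>x p y q. A.Z s \<alpha> = Step x p \<longrightarrow> B.Z u \<alpha> = Step y q \<longrightarrow>
        (p \<noteq> q \<longrightarrow> D (Inl x) \<and> D (Inr y)) \<and> (p = q \<longrightarrow> H x y))"
    unfolding all_conjuncts_iff A.zeta_Step[OF s] B.zeta_Step[OF u]
    by (simp add: conjunct_holds_def same left right both cong: imp_cong) blast
  also have "\<dots> \<longleftrightarrow> (\<forall>\<alpha>\<in>At T. matches D H (A.Z s \<alpha>) (B.Z u \<alpha>))"
  proof -
    have "matches D H o1 o2 \<longleftrightarrow> (o1 = Accept \<longleftrightarrow> o2 = Accept) \<and>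
        (\<forall>x p. o1 = Step x p \<longrightarrow> o2 = Reject \<longrightarrow> D (Inl x)) \<and>
        (\<forall>y q. o2 = Step y q \<longrightarrow> o1 = Reject \<longrightarrow> D (Inr y)) \<and>
        (\<forall>x p y q. o1 = Step x p \<longrightarrow> o2 = Step y q \<longrightarrow>
          (p \<noteq> q \<longrightarrow> D (Inl x) \<and> D (Inr y)) \<and> (p = q \<longrightarrow> H x y))"
      for o1 :: "('s, 'p) outcome" and o2 :: "('u, 'p) outcome"
      by (cases o1; cases o2) auto
    note matches = this
    show ?thesis unfolding matches by blast
  qed
  finally show ?thesis .
qed

section \<open>Correctness of the dead-state test\<close>

lemma nonblocked_closed: "nonblocked A B `` (states A <+> states B) \<subseteq> states A <+> states B"
  by (auto simp: nonblocked_def dest: A.deltaD(2) B.deltaD(2))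

lemma pick_class: "rep (pick \<sigma> rep x y) \<in> {rep x, rep y}"
proof -
  have "pick \<sigma> rep x y \<in> {z. rep z = rep x \<or> rep z = rep y}"
    using admissible unfolding admissible_def by blast
  then show ?thesis by simp
qed

lemma finite_states: "finite (states A <+> states B)"
  using A.finite_symbolic B.finite_symbolic
  by (auto simp: finite_symbolic_gkat_def symbolic_gkat_def)

lemma isdead_spec:
  assumes "x \<in> states A <+> states B" and "snd m \<subseteq> Collect (dead A B)"
  shows "\<exists>r m'. isdead A B \<sigma> x m = Some (r, m') \<and> fst m' = fst m \<and>
    snd m' \<subseteq> Collect (dead A B) \<and> (r \<longleftrightarrow> dead A B x)"
proof (cases "x \<in> snd m")
  case True
  then show ?thesis using assms by (auto simp: isdead_def)
next
  case False
  let ?V = "(nonblocked A B)\<^sup>* `` {x}"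
  have dfs: "dfs (succs \<sigma>) [x] {} = Some ?V"
    using admissible assms(1) finite_states nonblocked_closed
    by (intro dfs_reachable[of "states A <+> states B"]) (auto simp: admissible_def)
  have dead: "dead A B x \<longleftrightarrow> \<not> (\<exists>y\<in>?V. \<not> BigOr (eps_sum A B y) \<equiv>\<^sub>B\<^sub>A BZero)"
    by (auto simp: dead_def)
  \<comment> \<open>Whatever is reachable from a dead state is dead, so caching the whole reached
    set keeps the cache sound.\<close>
  have "?V \<subseteq> Collect (dead A B)" if "dead A B x"
    using that unfolding dead_def by (blast intro: rtrancl_trans)
  moreover have "isdead A B \<sigma> x m =
      Some (if dead A B x then (True, (fst m, snd m \<union> ?V)) else (False, m))"
    unfolding dead using False by (simp add: isdead_def dfs)
  ultimately show ?thesis using assms(2) by (cases "dead A B x") auto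
qed

end

text \<open>Interface shared by both claims. \<open>ISD\<close> has to decide \<open>D\<close>
  without touching the classes; \<open>KND\<close> only has to be sound, as a pair not recognized as
  dead is simply compared conjunct by conjunct.\<close>

locale equiv_run = symbolic_pair T \<Sigma> A B \<sigma>
  for T :: "'t set" and \<Sigma> :: "'p set" and A :: "('t, 's, 'p) symbolic_automaton"
    and B :: "('t, 'u, 'p) symbolic_automaton" and \<sigma> :: "('t, 's, 'u, 'p) strategy" +
  fixes ISD :: "'s + 'u \<Rightarrow> ('s + 'u) memory \<Rightarrow> (bool \<times> ('s + 'u) memory) option"
    and KND :: "'s + 'u \<Rightarrow> ('s + 'u) memory \<Rightarrow> bool"
    and D :: "'s + 'u \<Rightarrow> bool"
  assumes ISD: "\<And>x m. x \<in> states A <+> states B \<Longrightarrow> snd m \<subseteq> Collect (dead A B) \<Longrightarrow>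
      \<exists>r m'. ISD x m = Some (r, m') \<and> fst m' = fst m \<and> snd m' \<subseteq> Collect (dead A B) \<and> (r \<longleftrightarrow> D x)"
    and KND: "\<And>x m. KND x m \<Longrightarrow> snd m \<subseteq> Collect (dead A B) \<Longrightarrow> D x"
begin

abbreviation merged :: "('s + 'u) memory \<Rightarrow> 's \<Rightarrow> 'u \<Rightarrow> bool" where
  "merged m x y \<equiv> fst m (Inl x) = fst m (Inr y)"

text \<open>The two ways in which a true answer justifies a merge: an early return through the
  dead-state tests, or successful conjuncts, where a successful recursive call is read as membership
  in one class.\<close>

definition settled :: "('s + 'u) memory \<Rightarrow> 's \<Rightarrow> 'u \<Rightarrow> bool" where
  "settled m x y \<longleftrightarrow> x \<in> states A \<and> y \<in> states B \<and>
     (D (Inl x) \<and> D (Inr y) \<or> (\<forall>c\<in>conjuncts A B x y. conjunct_holds A B D (merged m) x y c))"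

text \<open>The quantification over equivalence relations \<open>Q\<close> says that the merges between \<open>m\<close> and \<open>m'\<close> are
  generated by pairs that are settled in \<open>m'\<close>.\<close>

definition extends :: "('s + 'u) memory \<Rightarrow> ('s + 'u) memory \<Rightarrow> bool" where
  "extends m m' \<longleftrightarrow> (\<forall>z w. fst m z = fst m w \<longrightarrow> fst m' z = fst m' w) \<and>
     (\<forall>Q. equivp Q \<longrightarrow> (\<forall>z w. fst m z = fst m w \<longrightarrow> Q z w) \<longrightarrow>
        (\<forall>x y. settled m' x y \<longrightarrow> Q (Inl x) (Inr y)) \<longrightarrow> (\<forall>z w. fst m' z = fst m' w \<longrightarrow> Q z w))"

definition valid :: "('s + 'u) memory \<Rightarrow> bool" where
  "valid m \<longleftrightarrow> valid_rep (fst m) \<and> snd m \<subseteq> Collect (dead A B)"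

text \<open>The termination measure is the cardinality of this set. It never grows along
  \<open>extends\<close> and drops strictly with each merge of two different classes; the
  restriction to states makes it finite.\<close>

definition separated :: "('s + 'u) memory \<Rightarrow> (('s + 'u) \<times> ('s + 'u)) set" where
  "separated m = {(z, w) \<in> (states A <+> states B) \<times> (states A <+> states B). fst m z \<noteq> fst m w}"

lemma finite_separated: "finite (separated m)"
  by (rule finite_subset[of _ "(states A <+> states B) \<times> (states A <+> states B)"])
    (use finite_states in \<open>auto simp: separated_def\<close>)

lemma conjunct_holds_mono:
  "(\<And>x y. H x y \<Longrightarrow> H' x y) \<Longrightarrow> conjunct_holds A B D H s u c \<Longrightarrow> conjunct_holds A B D H' s u c"
  by (cases c) (auto simp: conjunct_holds_def split: prod.splits)

lemma extendsD: "extends m m' \<Longrightarrow> fst m z = fst m w \<Longrightarrow> fst m' z = fst m' w"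
  unfolding extends_def by blast

lemma extends_least:
  assumes "extends m m'" "equivp Q" "\<And>z w. fst m z = fst m w \<Longrightarrow> Q z w"
    and "\<And>x y. settled m' x y \<Longrightarrow> Q (Inl x) (Inr y)" and "fst m' z = fst m' w"
  shows "Q z w"
proof -
  have "equivp Q \<longrightarrow> (\<forall>z w. fst m z = fst m w \<longrightarrow> Q z w) \<longrightarrow>
      (\<forall>x y. settled m' x y \<longrightarrow> Q (Inl x) (Inr y)) \<longrightarrow> (\<forall>z w. fst m' z = fst m' w \<longrightarrow> Q z w)"
    using conjunct2[OF assms(1)[unfolded extends_def]] by (rule spec)
  with assms(2-) show ?thesis by simp
qed

lemma extends_holds:
  "extends m m' \<Longrightarrow> conjunct_holds A B D (merged m) s u c \<Longrightarrow> conjunct_holds A B D (merged m') s u c"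
  by (erule conjunct_holds_mono[rotated]) (rule extendsD)

lemma extends_settled:
  assumes "extends m m'" "settled m x y"
  shows "settled m' x y"
  using assms(2) extends_holds[OF assms(1)] unfolding settled_def by auto

lemma extends_same: "fst m = fst m' \<Longrightarrow> extends m m'"
  by (simp add: extends_def)

lemma extends_trans:
  assumes "extends l m" "extends m n"
  shows "extends l n"
  unfolding extends_def
proof (intro conjI allI impI)
  show "fst n z = fst n w" if "fst l z = fst l w" for z w
    using that assms by (meson extendsD)
  fix Q z w
  assume Q: "equivp Q" "\<forall>z w. fst l z = fst l w \<longrightarrow> Q z w"
    "\<forall>x y. settled n x y \<longrightarrow> Q (Inl x) (Inr y)" and "fst n z = fst n w"
  \<comment> \<open>Further merges only help a conjunct, so pairs settled in the intermediate memory
    are still settled in \<open>n\<close>. Hence \<open>Q\<close> contains them, and the first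
    extension can be applied.\<close>
  have "\<forall>x y. settled m x y \<longrightarrow> Q (Inl x) (Inr y)"
    using Q(3) extends_settled[OF assms(2)] by blast
  then have "\<forall>z w. fst m z = fst m w \<longrightarrow> Q z w" using assms(1) Q unfolding extends_def by blast
  then show "Q z w" using assms(2) Q \<open>fst n z = fst n w\<close> unfolding extends_def by blast
qed

lemma extends_card: "extends m m' \<Longrightarrow> card (separated m') \<le> card (separated m)"
  by (intro card_mono finite_separated) (auto simp: separated_def dest: extendsD)

text \<open>\<open>EQ\<close> is the recursive call, assumed correct below the bound
  \<open>n\<close>. The bound belongs to the invariant so that every later conjunct may again make
  recursive calls.\<close>

lemma eval_conjunct_spec:
  assumes EQ: "\<And>x y m. \<lbrakk>x \<in> states A; y \<in> states B; valid m; card (separated m) < n\<rbrakk> \<Longrightarrow>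
      \<exists>r m'. EQ x y m = Some (r, m') \<and>
        (r \<longrightarrow> valid m' \<and> extends m m' \<and> merged m' x y) \<and> (H x y \<longrightarrow> r)"
    and s: "s \<in> states A" and u: "u \<in> states B" and c: "c \<in> conjuncts A B s u"
    and m: "valid m \<and> card (separated m) < n"
  shows "\<exists>r m'. eval_conjunct A B ISD EQ s u c m = Some (r, m') \<and>
    (r \<longrightarrow> (valid m' \<and> card (separated m') < n) \<and> extends m m' \<and>
      conjunct_holds A B D (merged m') s u c) \<and>
    (conjunct_holds A B D H s u c \<longrightarrow> r)"
proof -
  \<comment> \<open>A dead-state test leaves the classes alone, so neither the measure nor the
    merges are affected.\<close>
  have isd: "\<exists>r m'. ISD x m = Some (r, m') \<and>
      (r \<longrightarrow> (valid m' \<and> card (separated m') < n) \<and> extends m m' \<and> D x) \<and> (D x \<longrightarrow> r)"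
    if x: "x \<in> states A <+> states B" and m: "valid m \<and> card (separated m) < n" for x m
  proof -
    obtain r m' where "ISD x m = Some (r, m')" and m': "fst m' = fst m"
      "snd m' \<subseteq> Collect (dead A B)" and "r \<longleftrightarrow> D x"
      using ISD[OF x, of m] m by (auto simp: valid_def)
    moreover have "separated m' = separated m" by (simp add: separated_def m'(1))
    ultimately show ?thesis using m by (auto simp: valid_def intro: extends_same)
  qed
  \<comment> \<open>Conjuncts decided without any call: the comparison of acceptance, and the
    implications with a false premise (\<open>r\<close> is \<open>True\<close>).\<close>
  have triv: ?thesis if "eval_conjunct A B ISD EQ s u c m = Some (r, m)"
    "\<And>H. conjunct_holds A B D H s u c \<longleftrightarrow> r" for r
    using that m by (auto intro: extends_same)
  show ?thesis
  proof (cases c)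
    case SameAcceptance
    then show ?thesis by (intro triv) (auto simp: eval_conjunct_def conjunct_holds_def)
  next
    case (LeftRejected d)
    obtain b x p where d: "d = (b, x, p)" by (cases d)
    have x: "Inl x \<in> states A <+> states B"
      using c LeftRejected d A.deltaD(2)[OF _ s] by (auto simp: conjuncts_def)
    show ?thesis
    proof (cases "BAnd b (rho B u) \<equiv>\<^sub>B\<^sub>A BZero")
      case True
      then show ?thesis
        using LeftRejected d by (intro triv[of True]) (simp_all add: eval_conjunct_def conjunct_holds_def)
    next
      case False
      then have "eval_conjunct A B ISD EQ s u c m = ISD (Inl x) m"
        "\<And>H. conjunct_holds A B D H s u c \<longleftrightarrow> D (Inl x)"
        using LeftRejected d by (simp_all add: eval_conjunct_def conjunct_holds_def)
      then show ?thesis using isd[OF x m] by simp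
    qed
  next
    case (RightRejected d)
    obtain b x p where d: "d = (b, x, p)" by (cases d)
    have x: "Inr x \<in> states A <+> states B"
      using c RightRejected d B.deltaD(2)[OF _ u] by (auto simp: conjuncts_def)
    show ?thesis
    proof (cases "BAnd b (rho A s) \<equiv>\<^sub>B\<^sub>A BZero")
      case True
      then show ?thesis
        using RightRejected d by (intro triv[of True]) (simp_all add: eval_conjunct_def conjunct_holds_def)
    next
      case False
      then have "eval_conjunct A B ISD EQ s u c m = ISD (Inr x) m"
        "\<And>H. conjunct_holds A B D H s u c \<longleftrightarrow> D (Inr x)"
        using RightRejected d by (simp_all add: eval_conjunct_def conjunct_holds_def)
      then show ?thesis using isd[OF x m] by simp
    qed
  next
    case (DifferentActions d e)
    obtain b x p where d: "d = (b, x, p)" by (cases d)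
    obtain a y q where e: "e = (a, y, q)" by (cases e)
    let ?xs = "[Inl x, Inr y]"
    have xs: "z \<in> states A <+> states B" if "z \<in> set ?xs" for z
      using that c DifferentActions d e A.deltaD(2)[OF _ s] B.deltaD(2)[OF _ u]
      by (auto simp: conjuncts_def)
    have run: "\<exists>r m'. eval_all ISD ?xs m = Some (r, m') \<and>
        (r \<longrightarrow> (valid m' \<and> card (separated m') < n) \<and> extends m m' \<and> (\<forall>z\<in>set ?xs. D z)) \<and>
        ((\<forall>z\<in>set ?xs. D z) \<longrightarrow> r)"
    proof (rule eval_all_spec)
      show "\<exists>r m'. ISD z m = Some (r, m') \<and>
          (r \<longrightarrow> (valid m' \<and> card (separated m') < n) \<and> extends m m' \<and> D z) \<and> (D z \<longrightarrow> r)"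
        if "z \<in> set ?xs" "valid m \<and> card (separated m) < n" for z m
        by (rule isd[OF xs[OF that(1)] that(2)])
    next
      show "extends m m" for m by (rule extends_same) simp
    next
      show "extends l n" if "extends l m" "extends m n" for l m n
        using that by (rule extends_trans)
    qed (use m in simp_all)
    show ?thesis
    proof (cases "\<not> BAnd b a \<equiv>\<^sub>B\<^sub>A BZero \<and> p \<noteq> q")
      case True
      then have "eval_conjunct A B ISD EQ s u c m = eval_all ISD ?xs m"
        "\<And>H. conjunct_holds A B D H s u c \<longleftrightarrow> (\<forall>z\<in>set ?xs. D z)"
        using DifferentActions d e
        by (simp_all add: eval_conjunct_def conjunct_holds_def del: eval_all.simps)
      then show ?thesis using run by (simp del: eval_all.simps)
    next
      case False
      then show ?thesis
        using DifferentActions d e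
        by (intro triv[of True]) (auto simp: eval_conjunct_def conjunct_holds_def)
    qed
  next
    case (SameAction d e)
    obtain b x p where d: "d = (b, x, p)" by (cases d)
    obtain a y q where e: "e = (a, y, q)" by (cases e)
    have xy: "x \<in> states A" "y \<in> states B"
      using c SameAction d e A.deltaD(2)[OF _ s] B.deltaD(2)[OF _ u]
      by (auto simp: conjuncts_def)
    show ?thesis
    proof (cases "\<not> BAnd b a \<equiv>\<^sub>B\<^sub>A BZero \<and> p = q")
      case True
      then have "eval_conjunct A B ISD EQ s u c m = EQ x y m"
        and "\<And>H. conjunct_holds A B D H s u c \<longleftrightarrow> H x y"
        using SameAction d e by (simp_all add: eval_conjunct_def conjunct_holds_def)
      moreover obtain r m' where "EQ x y m = Some (r, m')"
        "r \<longrightarrow> valid m' \<and> extends m m' \<and> merged m' x y" "H x y \<longrightarrow> r"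
        using EQ[OF xy] m by blast
      moreover have "card (separated m') < n" if "extends m m'"
        using extends_card[OF that] m by simp
      ultimately show ?thesis by simp
    next
      case False
      then show ?thesis
        using SameAction d e
        by (intro triv[of True]) (auto simp: eval_conjunct_def conjunct_holds_def)
    qed
  qed
qed

text \<open>Induction on a bound for the number of separated pairs. Inside nested calls the pairs of
  the enclosing calls are merged but not yet settled, so the claim is relative to the initial
  memory: only the merges made since then are justified. \<open>H\<close> is any relation preserved
  by one step modulo \<open>D\<close>; it yields completeness. Agreement of \<open>D\<close> on
  \<open>H\<close>-related states covers the early returns.\<close>

lemma equiv_states_spec:
  assumes H: "\<And>x y. \<lbrakk>H x y; x \<in> states A; y \<in> states B\<rbrakk> \<Longrightarrow> D (Inl x) = D (Inr y) \<and>
      (\<forall>c\<in>conjuncts A B x y. conjunct_holds A B D H x y c)"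
    and "s \<in> states A" "u \<in> states B" "valid m" "card (separated m) < n"
  shows "\<exists>r m'. equiv_states A B \<sigma> ISD KND s u m = Some (r, m') \<and>
    (r \<longrightarrow> valid m' \<and> extends m m' \<and> merged m' s u) \<and> (H s u \<longrightarrow> r)"
  using assms(2-)
proof (induction n arbitrary: s u m)
  case 0
  then show ?case by simp
next
  case (Suc n)
  note s = Suc.prems(1) and u = Suc.prems(2)
  show ?case
  proof (cases "merged m s u")
    case True
    then show ?thesis using Suc.prems 
      by (subst equiv_states.simps) (intro exI[of _ True] exI[of _ m], simp add: extends_same)
  next
    case False
    let ?u = "uf_union (pick \<sigma>) (Inl s) (Inr u) (fst m)"
    let ?m = "(?u, snd m)"
    have pick: "fst m (pick \<sigma> (fst m) (Inl s) (Inr u)) \<in> {fst m (Inl s), fst m (Inr u)}"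
      by (rule pick_class)
    have mono: "?u z = ?u w" if "fst m z = fst m w" for z w using that by (rule uf_union_mono)
    have merges: "?u (Inl s) = ?u (Inr u)" by (rule uf_union_merges)
    have valid: "valid ?m"
      using Suc.prems(3) pick valid_rep_union[of "fst m" "pick \<sigma>" "Inl s" "Inr u"] by (simp add: valid_def)
    have "separated ?m \<subseteq> separated m" by (auto simp: separated_def dest: mono)
    moreover have "(Inl s, Inr u) \<in> separated m - separated ?m"
      using False s u merges by (auto simp: separated_def)
    ultimately have "card (separated ?m) < card (separated m)"
      by (intro psubset_card_mono finite_separated) auto
    then have small: "card (separated ?m) < n" using Suc.prems(4) by simp
    \<comment> \<open>The merge of \<open>s\<close> and \<open>u\<close> precedes its justification
      and thus belongs to the starting memory \<open>?m\<close> of the conjuncts. Once the pair is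
      settled in \<open>m'\<close>, the merge itself is generated by a settled pair, and the
      starting point moves back to \<open>m\<close>.\<close>
    have extends: "extends m m'" "merged m' s u" if "extends ?m m'" "settled m' s u" for m'
    proof -
      show "merged m' s u" by (rule extendsD[OF that(1)]) (simp add: merges)
      show "extends m m'"
        unfolding extends_def
      proof (intro conjI allI impI)
        show "fst m' z = fst m' w" if "fst m z = fst m w" for z w
          by (rule extendsD[OF \<open>extends ?m m'\<close>]) (simp add: mono[OF that])
        fix Q z w
        assume Q: "equivp Q" "\<forall>z w. fst m z = fst m w \<longrightarrow> Q z w"
          "\<forall>x y. settled m' x y \<longrightarrow> Q (Inl x) (Inr y)" and w: "fst m' z = fst m' w"
        show "Q z w"
        proof (rule extends_least[OF that(1) Q(1) _ _ w])
          have "valid_rep (fst m)" using Suc.prems(3) by (simp add: valid_def)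
          moreover have "Q (Inl s) (Inr u)" using Q(3) that(2) by simp
          ultimately show "Q z w" if "fst ?m z = fst ?m w" for z w
            using uf_union_least[of "fst m" "pick \<sigma>" "Inl s" "Inr u" Q z w] pick Q(1,2) that by simp
        qed (use Q(3) in simp)
      qed
    qed
    \<comment> \<open>Both early returns at once: one of the two states is known to satisfy
      \<open>D\<close>, and the test of the other one, \<open>x\<close>, decides whether both
      do.\<close>
    have isd: ?thesis
      if run: "equiv_states A B \<sigma> ISD KND s u m = ISD x ?m" and x: "x \<in> states A <+> states B"
        and D: "D x \<longleftrightarrow> D (Inl s) \<and> D (Inr u)" "H s u \<Longrightarrow> D x" for x
    proof -
      obtain r m' where m': "ISD x ?m = Some (r, m')" "fst m' = fst ?m"
        "snd m' \<subseteq> Collect (dead A B)" "r \<longleftrightarrow> D x"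
        using ISD[OF x, of ?m] valid by (auto simp: valid_def)
      have "valid m' \<and> extends m m' \<and> merged m' s u" if r
      proof -
        have "settled m' s u" using that m'(4) D(1) s u by (simp add: settled_def)
        moreover have "valid m'" using m'(2,3) valid by (simp add: valid_def)
        ultimately show ?thesis using extends[OF extends_same[OF m'(2)[symmetric]]] by simp
      qed
      then show ?thesis using run m'(1,4) D(2) by (intro exI[of _ r] exI[of _ m']) simp
    qed
    have known: "D x" if "KND x ?m" for x using KND[OF that] valid by (simp add: valid_def)
    consider "KND (Inl s) ?m" | "\<not> KND (Inl s) ?m" "KND (Inr u) ?m"
      | "\<not> KND (Inl s) ?m" "\<not> KND (Inr u) ?m" by blast
    then show ?thesis
    proof cases
      case 1
      then have "equiv_states A B \<sigma> ISD KND s u m = ISD (Inr u) ?m"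
        using False by (subst equiv_states.simps) (simp add: Let_def)
      then show ?thesis by (rule isd) (use known[OF 1] H[of s u] s u in auto)
    next
      case 2
      then have "equiv_states A B \<sigma> ISD KND s u m = ISD (Inl s) ?m"
        using False by (subst equiv_states.simps) (simp add: Let_def)
      then show ?thesis by (rule isd) (use known[OF 2(2)] H[of s u] s u in auto)
    next
      case 3
      let ?f = "eval_conjunct A B ISD (equiv_states A B \<sigma> ISD KND) s u"
      have order: "set (order \<sigma> s u) = conjuncts A B s u"
        using admissible s u by (auto simp: admissible_def)
      have "\<exists>r m'. eval_all ?f (order \<sigma> s u) ?m = Some (r, m') \<and>
          (r \<longrightarrow> (valid m' \<and> card (separated m') < n) \<and> extends ?m m' \<and>
            (\<forall>c\<in>set (order \<sigma> s u). conjunct_holds A B D (merged m') s u c)) \<and>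
          ((\<forall>c\<in>set (order \<sigma> s u). conjunct_holds A B D H s u c) \<longrightarrow> r)"
      \<comment> \<open>Each conjunct is first established in an intermediate memory;
        \<open>extends_holds\<close> carries it over to the final one, where the pair counts as
        settled.\<close>
      proof (rule eval_all_spec)
        fix c m assume "c \<in> set (order \<sigma> s u)" and "valid m \<and> card (separated m) < n"
        then show "\<exists>r m'. ?f c m = Some (r, m') \<and>
          (r \<longrightarrow> (valid m' \<and> card (separated m') < n) \<and> extends m m' \<and>
            conjunct_holds A B D (merged m') s u c) \<and> (conjunct_holds A B D H s u c \<longrightarrow> r)"
          using order by (intro eval_conjunct_spec Suc.IH s u) auto
      next
        show "extends m m" for m by (rule extends_same) simp
      next
        show "extends l n" if "extends l m" "extends m n" for l m n
          using that by (rule extends_trans)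
      next
        show "conjunct_holds A B D (merged m') s u c"
          if "extends m m'" "conjunct_holds A B D (merged m) s u c" for c m m'
          using that by (rule extends_holds)
      next
        show "valid ?m \<and> card (separated ?m) < n" using valid small by simp
      qed
      then obtain r m' where r: "eval_all ?f (order \<sigma> s u) ?m = Some (r, m')"
        and sound: "r \<longrightarrow> (valid m' \<and> card (separated m') < n) \<and> extends ?m m' \<and>
          (\<forall>c\<in>conjuncts A B s u. conjunct_holds A B D (merged m') s u c)"
        and complete: "(\<forall>c\<in>conjuncts A B s u. conjunct_holds A B D H s u c) \<longrightarrow> r"
        unfolding order by (elim exE conjE)
      have "equiv_states A B \<sigma> ISD KND s u m = Some (r, m')"
        using False 3 r by (subst equiv_states.simps) (simp add: Let_def)
      moreover have "valid m' \<and> extends m m' \<and> merged m' s u" if r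
      proof -
        have "valid m'" and ext: "extends ?m m'" and "settled m' s u"
          using sound that s u by (simp_all add: settled_def)
        then show ?thesis using extends[OF ext] by simp
      qed
      moreover have r if "H s u" using complete H[OF that s u] by simp
      ultimately show ?thesis by (intro exI[of _ r] exI[of _ m']) simp
    qed
  qed
qed

text \<open>With singleton classes at the start the relative claim becomes absolute: the final
  classes are contained in every equivalence relation that contains the settled pairs.\<close>

lemma equiv_states_fresh:
  assumes "s \<in> states A" "u \<in> states B" and "C \<subseteq> Collect (dead A B)"
    and H: "\<forall>x\<in>states A. \<forall>y\<in>states B. H x y \<longrightarrow> D (Inl x) = D (Inr y) \<and>
      (\<forall>\<alpha>\<in>At T. matches D H (A.Z x \<alpha>) (B.Z y \<alpha>))"
  obtains r m' where "equiv_states A B \<sigma> ISD KND s u (fresh_union_find, C) = Some (r, m')"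
    and "H s u \<longrightarrow> r" and "r \<longrightarrow> merged m' s u"
    and "\<forall>Q. r \<longrightarrow> equivp Q \<longrightarrow>
      (\<forall>x\<in>states A. \<forall>y\<in>states B. (D (Inl x) \<and> D (Inr y) \<or>
        (\<forall>\<alpha>\<in>At T. matches D (merged m') (A.Z x \<alpha>) (B.Z y \<alpha>))) \<longrightarrow> Q (Inl x) (Inr y)) \<longrightarrow>
      (\<forall>z w. fst m' z = fst m' w \<longrightarrow> Q z w)"
proof -
  let ?m = "(fresh_union_find, C)"
  have valid: "valid ?m" using assms(3) by (simp add: valid_def valid_rep_def fresh_union_find_def)
  have "\<exists>r m'. equiv_states A B \<sigma> ISD KND s u ?m = Some (r, m') \<and>
      (r \<longrightarrow> valid m' \<and> extends ?m m' \<and> merged m' s u) \<and> (H s u \<longrightarrow> r)"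
  \<comment> \<open>\<open>lessI\<close> chooses the successor of the initial number of separated
    pairs as the bound.\<close>
  proof (rule equiv_states_spec[OF _ assms(1,2) valid lessI])
    show "D (Inl x) = D (Inr y) \<and> (\<forall>c\<in>conjuncts A B x y. conjunct_holds A B D H x y c)"
      if "H x y" "x \<in> states A" "y \<in> states B" for x y
      using that H by (simp add: conjuncts_hold_iff)
  qed
  then obtain r m' where r: "equiv_states A B \<sigma> ISD KND s u ?m = Some (r, m')"
    "r \<longrightarrow> valid m' \<and> extends ?m m' \<and> merged m' s u" "H s u \<longrightarrow> r"
    by blast
  show ?thesis
  proof (rule that[OF r(1)])
    show "H s u \<longrightarrow> r" "r \<longrightarrow> merged m' s u" using r(2,3) by simp_all
  next
    show "\<forall>Q. r \<longrightarrow> equivp Q \<longrightarrow>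
      (\<forall>x\<in>states A. \<forall>y\<in>states B. (D (Inl x) \<and> D (Inr y) \<or>
        (\<forall>\<alpha>\<in>At T. matches D (merged m') (A.Z x \<alpha>) (B.Z y \<alpha>))) \<longrightarrow> Q (Inl x) (Inr y)) \<longrightarrow>
      (\<forall>z w. fst m' z = fst m' w \<longrightarrow> Q z w)"
    proof (intro allI impI)
      fix Q z w
      assume r and Q: "equivp Q" and "fst m' z = fst m' w"
        and gen: "\<forall>x\<in>states A. \<forall>y\<in>states B. (D (Inl x) \<and> D (Inr y) \<or>
          (\<forall>\<alpha>\<in>At T. matches D (merged m') (A.Z x \<alpha>) (B.Z y \<alpha>))) \<longrightarrow> Q (Inl x) (Inr y)"
      have "extends ?m m'" using r(2) \<open>r\<close> by simp
      then show "Q z w"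
      proof (rule extends_least[OF _ Q _ _ \<open>fst m' z = fst m' w\<close>])
        show "Q z w" if "fst ?m z = fst ?m w" for z w
          using that equivp_reflp[OF Q] by (simp add: fresh_union_find_def)
        show "Q (Inl x) (Inr y)" if "settled m' x y" for x y
        proof (rule gen[rule_format])
          show x: "x \<in> states A" and y: "y \<in> states B" using that by (simp_all add: settled_def)
          show "D (Inl x) \<and> D (Inr y) \<or>
              (\<forall>\<alpha>\<in>At T. matches D (merged m') (A.Z x \<alpha>) (B.Z y \<alpha>))"
            using that unfolding settled_def conjuncts_hold_iff[OF x y] by simp
        qed
      qed
    qed
  qed
qed

end


section \<open>Correctness\<close>

lemma is_trace_iff:
  "is_trace T X s w \<longleftrightarrow> (\<exists>\<alpha>\<in>At T. w = [Inl \<alpha>] \<and> zeta X s \<alpha> = Accept \<or>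
    (\<exists>p s' v. w = Inl \<alpha> # Inr p # v \<and> zeta X s \<alpha> = Step s' p \<and> is_trace T X s' v))"
  by (rule iffI, erule is_trace.cases) (auto intro: is_trace.intros)

lemma is_trace_accept_iff:
  "is_trace T X s [Inl \<alpha>] \<longleftrightarrow> \<alpha> \<in> At T \<and> zeta X s \<alpha> = Accept"
  by (auto elim: is_trace.cases intro: is_trace.intros)

lemma is_trace_step_iff:
  "is_trace T X s (Inl \<alpha> # Inr p # v) \<longleftrightarrow>
    \<alpha> \<in> At T \<and> (\<exists>s'. zeta X s \<alpha> = Step s' p \<and> is_trace T X s' v)"
  by (rule iffI, erule is_trace.cases) (auto intro: is_trace.intros)

context symbolic_pair
begin

text \<open>One-letter words compare acceptance, and words beginning with \<alpha> and
  \<open>p\<close> compare the trace sets of the targets. A step without a counterpart of the same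
  action must therefore lead to an empty trace set, that is, to a dead state.\<close>

lemma trace_equivalent_matches:
  assumes eq: "trace_equivalent T (concretization A) (concretization B) x y"
    and x: "x \<in> states A" and y: "y \<in> states B" and \<alpha>: "\<alpha> \<in> At T"
  shows "matches (dead A B) (trace_equivalent T (concretization A) (concretization B))
    (A.Z x \<alpha>) (B.Z y \<alpha>)"
proof -
  have L: "is_trace T (concretization A) x w \<longleftrightarrow> is_trace T (concretization B) y w" for w
    using eq by (auto simp: trace_equivalent_def traces_def)
  have acc: "A.Z x \<alpha> = Accept \<longleftrightarrow> B.Z y \<alpha> = Accept"
    using L[of "[Inl \<alpha>]"] \<alpha> by (simp add: is_trace_accept_iff)
  have step: "(\<exists>x'. A.Z x \<alpha> = Step x' p \<and> is_trace T (concretization A) x' v) \<longleftrightarrow>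
      (\<exists>y'. B.Z y \<alpha> = Step y' p \<and> is_trace T (concretization B) y' v)" for p v
    using L[of "Inl \<alpha> # Inr p # v"] \<alpha> by (simp add: is_trace_step_iff)
  have deadA: "dead A B (Inl x')" if "A.Z x \<alpha> = Step x' p" "\<And>y'. B.Z y \<alpha> \<noteq> Step y' p" for x' p
    using that step[of p] A.zeta_state[OF x that(1)] by (simp add: dead_Inl traces_def)
  have deadB: "dead A B (Inr y')" if "B.Z y \<alpha> = Step y' p" "\<And>x'. A.Z x \<alpha> \<noteq> Step x' p" for y' p
    using that step[of p] B.zeta_state[OF y that(1)] by (simp add: dead_Inr traces_def)
  have "trace_equivalent T (concretization A) (concretization B) x' y'"
    if "A.Z x \<alpha> = Step x' p" "B.Z y \<alpha> = Step y' p" for x' y' p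
    using that step[of p] by (simp add: trace_equivalent_def traces_def)
  with acc deadA deadB show ?thesis
    by (cases "A.Z x \<alpha>"; cases "B.Z y \<alpha>") simp_all
qed

theorem equiv_states_trace:
  assumes "s \<in> states A" "u \<in> states B" and "C \<subseteq> Collect (dead A B)"
  obtains r m' where
    "equiv_states A B \<sigma> (isdead A B \<sigma>) knowndead s u (fresh_union_find, C) = Some (r, m')"
    and "r \<longleftrightarrow> trace_equivalent T (concretization A) (concretization B) s u"
proof -
  interpret equiv_run T \<Sigma> A B \<sigma> "isdead A B \<sigma>" knowndead "dead A B"
    by unfold_locales (use isdead_spec in \<open>auto simp: knowndead_def\<close>)
  let ?H = "trace_equivalent T (concretization A) (concretization B)"
  have H: "\<forall>x\<in>states A. \<forall>y\<in>states B. ?H x y \<longrightarrow> dead A B (Inl x) = dead A B (Inr y) \<and>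
      (\<forall>\<alpha>\<in>At T. matches (dead A B) ?H (A.Z x \<alpha>) (B.Z y \<alpha>))"
    by (simp add: trace_equivalent_matches) (simp add: dead_Inl dead_Inr trace_equivalent_def)
  obtain r m' where
    run: "equiv_states A B \<sigma> (isdead A B \<sigma>) knowndead s u (fresh_union_find, C) = Some (r, m')"
    and complete: "?H s u \<longrightarrow> r" and su: "r \<longrightarrow> merged m' s u"
    and gen: "\<forall>Q. r \<longrightarrow> equivp Q \<longrightarrow>
      (\<forall>x\<in>states A. \<forall>y\<in>states B. (dead A B (Inl x) \<and> dead A B (Inr y) \<or>
        (\<forall>\<alpha>\<in>At T. matches (dead A B) (merged m') (A.Z x \<alpha>) (B.Z y \<alpha>))) \<longrightarrow> Q (Inl x) (Inr y)) \<longrightarrow>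
      (\<forall>z w. fst m' z = fst m' w \<longrightarrow> Q z w)"
    by (rule equiv_states_fresh[OF assms H])
  define L where
    "L = case_sum (is_trace T (concretization A)) (is_trace T (concretization B))"
  have "L z v = L w v" if r and "fst m' z = fst m' w" for z w v
    using that(2)
  \<comment> \<open>The induction is on length because a step consumes two letters, an atom and an
    action. It is stated for all pairs of a final class, since targets are only known to share a
    class.\<close>
  proof (induction v arbitrary: z w rule: length_induct)
    case (1 v)
    show ?case
    proof (rule gen[rule_format, where Q = "\<lambda>z w. L z v = L w v", OF \<open>r\<close> _ _ "1.prems"])
      show "equivp (\<lambda>z w. L z v = L w v)" by (intro equivpI reflpI sympI transpI) auto
      fix x y
      assume x: "x \<in> states A" and y: "y \<in> states B"
        and "dead A B (Inl x) \<and> dead A B (Inr y) \<or>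
          (\<forall>\<alpha>\<in>At T. matches (dead A B) (merged m') (A.Z x \<alpha>) (B.Z y \<alpha>))"
      then consider "dead A B (Inl x)" "dead A B (Inr y)"
        | "\<forall>\<alpha>\<in>At T. matches (dead A B) (merged m') (A.Z x \<alpha>) (B.Z y \<alpha>)" by blast
      then show "L (Inl x) v = L (Inr y) v"
      proof cases
        case 1
        then show ?thesis using x y by (simp add: dead_Inl dead_Inr traces_def L_def)
      next
        case 2
        have IH: "is_trace T (concretization A) x' v' = is_trace T (concretization B) y' v'"
          if "merged m' x' y'" "length v' < length v" for x' y' v'
          using "1.IH"[rule_format, OF that(2,1)] by (simp add: L_def)
        have step: "(\<exists>p x' v'. v = Inl \<alpha> # Inr p # v' \<and> A.Z x \<alpha> = Step x' p \<and>
              is_trace T (concretization A) x' v') \<longleftrightarrow>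
            (\<exists>p y' v'. v = Inl \<alpha> # Inr p # v' \<and> B.Z y \<alpha> = Step y' p \<and>
              is_trace T (concretization B) y' v')" (is "?tA \<longleftrightarrow> ?tB")
          and accept: "A.Z x \<alpha> = Accept \<longleftrightarrow> B.Z y \<alpha> = Accept" if \<alpha>: "\<alpha> \<in> At T" for \<alpha>
        proof -
          have m: "matches (dead A B) (merged m') (A.Z x \<alpha>) (B.Z y \<alpha>)" by (rule bspec[OF 2 \<alpha>])
          then show "A.Z x \<alpha> = Accept \<longleftrightarrow> B.Z y \<alpha> = Accept"
            by (cases "A.Z x \<alpha>"; cases "B.Z y \<alpha>") simp_all
          show "?tA \<longleftrightarrow> ?tB"
          proof
            assume ?tA
            then obtain p x' v' where v: "v = Inl \<alpha> # Inr p # v'" and x': "A.Z x \<alpha> = Step x' p"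
              and tr: "is_trace T (concretization A) x' v'" by blast
            \<comment> \<open>The remaining word is a trace of the target, so the exemption for dead
              targets cannot apply, and matching must provide a step with the same action.\<close>
            have "\<not> dead A B (Inl x')"
              using dead_Inl[OF A.zeta_state[OF x x']] tr by (auto simp: traces_def)
            then obtain y' where "B.Z y \<alpha> = Step y' p" "merged m' x' y'"
              using m x' by (cases "B.Z y \<alpha>") (auto split: if_splits)
            then show ?tB using v tr IH[of x' y' v'] by simp
          next
            assume ?tB
            then obtain p y' v' where v: "v = Inl \<alpha> # Inr p # v'" and y': "B.Z y \<alpha> = Step y' p"
              and tr: "is_trace T (concretization B) y' v'" by blast
            have "\<not> dead A B (Inr y')"
              using dead_Inr[OF B.zeta_state[OF y y']] tr by (auto simp: traces_def)
            then obtain x' where "A.Z x \<alpha> = Step x' p" "merged m' x' y'"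
              using m y' by (cases "A.Z x \<alpha>") (auto split: if_splits)
            then show ?tA using v tr IH[of x' y' v'] by simp
          qed
        qed
        show ?thesis
          unfolding L_def sum.case is_trace_iff[of _ _ _ v]
        proof (rule bex_cong[OF HOL.refl])
          fix \<alpha> assume "\<alpha> \<in> At T"
          from step[OF this] accept[OF this] show "v = [Inl \<alpha>] \<and> A.Z x \<alpha> = Accept \<or>
              (\<exists>p x' v'. v = Inl \<alpha> # Inr p # v' \<and> A.Z x \<alpha> = Step x' p \<and>
                is_trace T (concretization A) x' v') \<longleftrightarrow>
            v = [Inl \<alpha>] \<and> B.Z y \<alpha> = Accept \<or>
              (\<exists>p y' v'. v = Inl \<alpha> # Inr p # v' \<and> B.Z y \<alpha> = Step y' p \<and>
                is_trace T (concretization B) y' v')"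
            by (simp only:)
        qed
      qed
    qed
  qed
  from this[of "Inl s" "Inr u"] have "L (Inl s) v = L (Inr u) v" if r for v using that su by blast
  then have "?H s u" if r using that by (simp add: L_def trace_equivalent_def traces_def)
  with run complete show ?thesis using that by blast
qed

theorem equiv_states_bisim:
  assumes "s \<in> states A" "u \<in> states B" and "C \<subseteq> Collect (dead A B)"
  obtains r m' where
    "equiv_states A B \<sigma> (\<lambda>_ m. Some (False, m)) (\<lambda>_ _. False) s u (fresh_union_find, C)
      = Some (r, m')"
    and "r \<longleftrightarrow> bisimilar T (concretization A) (concretization B) s u"
proof -
  let ?I = "\<lambda>(_ :: 's + 'u) m. Some (False, m)"
  interpret equiv_run T \<Sigma> A B \<sigma> ?I "\<lambda>_ _. False" "\<lambda>_. False"
    by unfold_locales auto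
  let ?H = "bisimilar T (concretization A) (concretization B)"
  have matches_False: "matches (\<lambda>_. False) H a b \<longleftrightarrow> a = Accept \<and> b = Accept \<or>
      a = Reject \<and> b = Reject \<or> (\<exists>p x y. a = Step x p \<and> b = Step y p \<and> H x y)"
    for H :: "'s \<Rightarrow> 'u \<Rightarrow> bool" and a :: "('s, 'p) outcome" and b
    by (cases a; cases b) auto
  have "matches (\<lambda>_. False) ?H (A.Z x \<alpha>) (B.Z y \<alpha>)" if "?H x y" "\<alpha> \<in> At T" for x y \<alpha>
  proof -
    obtain R where R: "bisimulation T (concretization A) (concretization B) R" "(x, y) \<in> R"
      using \<open>?H x y\<close> unfolding bisimilar_def by blast
    then have "matches (\<lambda>_. False) (\<lambda>x y. (x, y) \<in> R) (A.Z x \<alpha>) (B.Z y \<alpha>)"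
      using \<open>\<alpha> \<in> At T\<close> unfolding bisimulation_def matches_False by fast
    \<comment> \<open>The bisimulation that witnesses one pair also witnesses all its other pairs,
      so matching modulo \<open>R\<close> is matching modulo bisimilarity.\<close>
    moreover have "?H x' y'" if "(x', y') \<in> R" for x' y'
      using that R(1) unfolding bisimilar_def by blast
    ultimately show ?thesis unfolding matches_False by blast
  qed
  then have H: "\<forall>x\<in>states A. \<forall>y\<in>states B. ?H x y \<longrightarrow> False = False \<and>
      (\<forall>\<alpha>\<in>At T. matches (\<lambda>_. False) ?H (A.Z x \<alpha>) (B.Z y \<alpha>))" by simp
  obtain r m' where
    run: "equiv_states A B \<sigma> ?I (\<lambda>_ _. False) s u (fresh_union_find, C) = Some (r, m')"
    and complete: "?H s u \<longrightarrow> r" and su: "r \<longrightarrow> merged m' s u"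
    and gen: "\<forall>Q. r \<longrightarrow> equivp Q \<longrightarrow>
      (\<forall>x\<in>states A. \<forall>y\<in>states B. (False \<and> False \<or>
        (\<forall>\<alpha>\<in>At T. matches (\<lambda>_. False) (merged m') (A.Z x \<alpha>) (B.Z y \<alpha>))) \<longrightarrow> Q (Inl x) (Inr y)) \<longrightarrow>
      (\<forall>z w. fst m' z = fst m' w \<longrightarrow> Q z w)"
    by (rule equiv_states_fresh[OF assms H])
  have "?H s u" if r
  proof -
    text \<open>Targets are replaced by their representatives, so that matching modulo the final
      classes becomes equality and hence an equivalence relation.\<close>
    define N :: "'s + 'u \<Rightarrow> 't atom \<Rightarrow> ('s + 'u, 'p) outcome" where
      "N z \<alpha> = (case z of
         Inl x \<Rightarrow> map_outcome (\<lambda>x. fst m' (Inl x)) id (A.Z x \<alpha>)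
       | Inr y \<Rightarrow> map_outcome (\<lambda>y. fst m' (Inr y)) id (B.Z y \<alpha>))" for z \<alpha>
    have N: "N (Inl x) \<alpha> = N (Inr y) \<alpha> \<longleftrightarrow> matches (\<lambda>_. False) (merged m') (A.Z x \<alpha>) (B.Z y \<alpha>)"
      for x y \<alpha>
      unfolding N_def by (cases "A.Z x \<alpha>"; cases "B.Z y \<alpha>") auto
    have same: "\<forall>\<alpha>\<in>At T. N z \<alpha> = N w \<alpha>" if "fst m' z = fst m' w" for z w
    proof (rule gen[rule_format, where Q = "\<lambda>z w. \<forall>\<alpha>\<in>At T. N z \<alpha> = N w \<alpha>", OF \<open>r\<close> _ _ that])
      show "equivp (\<lambda>z w. \<forall>\<alpha>\<in>At T. N z \<alpha> = N w \<alpha>)"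
        by (intro equivpI reflpI sympI transpI) auto
    qed (simp add: N)
    \<comment> \<open>The bisimulation is read off the final classes. Restricting it to states meets
      the domain condition and is harmless, because transitions stay inside the automata.\<close>
    define R where "R = {(x, y) \<in> states A \<times> states B. merged m' x y}"
    have R: "(x, y) \<in> R \<longleftrightarrow> x \<in> states A \<and> y \<in> states B \<and> merged m' x y" for x y
      by (simp add: R_def)
    have "matches (\<lambda>_. False) (\<lambda>x y. (x, y) \<in> R) (A.Z x \<alpha>) (B.Z y \<alpha>)"
      if "(x, y) \<in> R" "\<alpha> \<in> At T" for x y \<alpha>
    proof -
      have "matches (\<lambda>_. False) (merged m') (A.Z x \<alpha>) (B.Z y \<alpha>)"
        using same[of "Inl x" "Inr y"] that N[of x \<alpha> y] by (simp add: R)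
      moreover have "(x', y') \<in> R"
        if "A.Z x \<alpha> = Step x' p" "B.Z y \<alpha> = Step y' p" "merged m' x' y'" for x' y' p
        using that \<open>(x, y) \<in> R\<close> A.zeta_state B.zeta_state unfolding R by blast
      ultimately show ?thesis unfolding matches_False by blast
    qed
    moreover have "R \<subseteq> gstates (concretization A) \<times> gstates (concretization B)"
      by (auto simp: R concretization_def)
    ultimately have "bisimulation T (concretization A) (concretization B) R"
      unfolding bisimulation_def matches_False by blast
    moreover have "(s, u) \<in> R" using assms(1,2) su \<open>r\<close> by (simp add: R)
    ultimately show ?thesis unfolding bisimilar_def by blast
  qed
  with run complete show ?thesis using that by blast
qed

end

theorem theorem3p7:
  fixes T :: "'t set" and \<Sigma> :: "'p set"
    and A :: "('t, 's, 'p) symbolic_automaton"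
    and B :: "('t, 'u, 'p) symbolic_automaton"
    and s :: 's and u :: 'u
    and \<sigma> :: "('t, 's, 'u, 'p) strategy"
    and C :: "('s + 'u) set"
  assumes "finite T"
    and "finite_symbolic_gkat T \<Sigma> A"
    and "finite_symbolic_gkat T \<Sigma> B"
    and "s \<in> states A" and "u \<in> states B"
    and "admissible A B \<sigma>"
    and "C \<subseteq> {x \<in> states A <+> states B. dead A B x}"
  shows "terminates (equiv_states A B \<sigma> (isdead A B \<sigma>) knowndead s u (fresh_union_find, C)) \<and>
    terminates
      (equiv_states A B \<sigma> (\<lambda>_ m. Some (False, m)) (\<lambda>_ _. False) s u (fresh_union_find, C)) \<and>
    (returns_true (equiv_states A B \<sigma> (isdead A B \<sigma>) knowndead s u (fresh_union_find, C))
      \<longleftrightarrow> trace_equivalent T (concretization A) (concretization B) s u) \<and>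
    (returns_true
      (equiv_states A B \<sigma> (\<lambda>_ m. Some (False, m)) (\<lambda>_ _. False) s u (fresh_union_find, C))
      \<longleftrightarrow> bisimilar T (concretization A) (concretization B) s u)"
proof -
  interpret symbolic_pair T \<Sigma> A B \<sigma>
    using assms by unfold_locales
  \<comment> \<open>Soundness of the initial cache is all that a run relies on; the cache may stem
    from earlier calls.\<close>
  have C: "C \<subseteq> Collect (dead A B)" using assms(7) by auto
  obtain r m' where
    "equiv_states A B \<sigma> (isdead A B \<sigma>) knowndead s u (fresh_union_find, C) = Some (r, m')"
    "r \<longleftrightarrow> trace_equivalent T (concretization A) (concretization B) s u"
    by (rule equiv_states_trace[OF assms(4,5) C])
  moreover obtain r' m'' where
    "equiv_states A B \<sigma> (\<lambda>_ m. Some (False, m)) (\<lambda>_ _. False) s u (fresh_union_find, C)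
      = Some (r', m'')"
    "r' \<longleftrightarrow> bisimilar T (concretization A) (concretization B) s u"
    by (rule equiv_states_bisim[OF assms(4,5) C])
  ultimately show ?thesis by (simp add: terminates_def returns_true_def)
qed

end
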